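(* Let $d \geq 1$ be an integer, let $H_1, \dots, H_{2d} \subset \mathbb{R}^d$ be closed halfspaces, each containing the Euclidean unit ball $\mathbf{B}^d$, and put $P = \bigcap_{i=1}^{2d} H_i$. Then $P$ contains a point $x$ with \[ |x| \geq \sqrt{d}. \] Moreover, if $\max_{x \in P} |x| = \sqrt{d}$, then $P$ is an orthogonal image of the cube $[-1,1]^d$, that is, $P = U([-1,1]^d)$ for some orthogonal transformation $U$ of $\mathbb{R}^d$.
   Context: $|\cdot|$ denotes the Euclidean norm on $\mathbb{R}^d$, and $\mathbf{B}^d = \{x \in \mathbb{R}^d : |x| \leq 1\}$. The halfspaces are not assumed to have the origin on their boundary. *)

theory Defs
  imports "HOL-Analysis.Analysis"
begin

definition closed_halfspace :: "'a::real_inner set \<Rightarrow> bool" where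
  "closed_halfspace H \<longleftrightarrow> (\<exists>a b. a \<noteq> 0 \<and> H = {x. a \<bullet> x \<le> b})"

end

theory Submission imports Defs "HOL-Computational_Algebra.Polynomial" begin

text \<open>Each halfspace has the form \<open>{x. u i \<bullet> x \<le> b i}\<close> with a unit vector \<open>u i\<close> and \<open>b i \<ge> 1\<close>, so \<open>P\<close>
contains \<open>Q = {x. \<forall>i. u i \<bullet> x \<le> 1}\<close>. If \<open>Q\<close> is unbounded, it has far points; otherwise the proof
computes with the second moment of a random vertex \<open>X\<close> of \<open>Q\<close>. Write \<open>d\<close> for the dimension.

The random vertex. A basis of \<open>d\<close> normals that defines a vertex is chosen with probability proportional
to the absolute value of its determinant. Geometrically this is the volume that the corresponding facet
of the polar body \<open>conv {u i}\<close> spans with the origin. This choice has two exact consequences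
(\<open>exists_vertex_measure\<close>), where \<open>E\<close> denotes expectation:
\<open>E X = 0\<close> and \<open>E (\<Sum>i tight. (u i \<bullet> p) * (X \<bullet> q)) = p \<bullet> q\<close> for all \<open>p\<close> and \<open>q\<close>.
Both come from a cancellation along edges (\<open>sum_flags_eq_0\<close>). The vertex is the sum of the vectors dual to its
tight normals, each dual vector points along an edge, and the absolute value of the determinant times the
dual vector takes opposite values at the two ends of the edge. In the second identity the terms in which
the dual vector and the normal have the same index survive, and they add up to \<open>p \<bullet> q\<close> at every
vertex. The pairing of the ends of edges needs a simple polytope. Therefore the bases are selected by means of a slightly
perturbed right-hand side; the weights and the dual vectors do not depend on that right-hand side.

The bound. Let \<open>\<tau> i\<close> be the indicator of the event that \<open>i\<close> belongs to the chosen basis and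
\<open>\<pi> i = E (\<tau> i)\<close>. Since the basis has \<open>d\<close> of the \<open>2 * d\<close> indices,
\<open>(\<Sum>i. 1 - \<pi> i) = d\<close>. In an orthonormal basis of principal axes \<open>b\<close> of \<open>X\<close>, let
\<open>m b = E (X \<bullet> b)\<^sup>2\<close> and \<open>k b = (\<Sum>i. (1 - \<pi> i) * (u i \<bullet> b)\<^sup>2)\<close>, so that \<open>(\<Sum>b. m b) = E (norm X)\<^sup>2\<close>
and \<open>(\<Sum>b. k b) = d\<close>. Expanding
\<open>0 \<le> E (\<tau> i - \<pi> i - (1 - \<pi> i) * (\<Sum>b. \<theta> b * (u i \<bullet> b) * (X \<bullet> b)))\<^sup>2\<close>, dividing by \<open>1 - \<pi> i\<close> and summing
over \<open>i\<close> yields \<open>0 \<le> d - 2 * (\<Sum>b. \<theta> b) + (\<Sum>b. (\<theta> b)\<^sup>2 * m b * k b)\<close> by the two identities. With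
\<open>\<theta> b = 2 / (m b + k b)\<close> this becomes \<open>E (norm X)\<^sup>2 \<ge> d\<close> after an application of \<open>a + 1 / a \<ge> 2\<close>; the lemma
\<open>excess_eq_sum_of_squares\<close> records the difference as an explicit sum of nonnegative terms.

Equality. If no point of \<open>P\<close> is longer than \<open>sqrt d\<close>, all these terms vanish. Then \<open>\<pi> i = 1 / 2\<close>, and at a
chosen vertex every \<open>u i \<bullet> X\<close> is \<open>1\<close> or \<open>- 1\<close>. Walking from that vertex along an edge must not leave the
ball of radius \<open>sqrt d\<close>; comparing lengths forces the tight normals to be orthonormal and the opposite
of each of them to be a normal as well (\<open>facets_if_extremal\<close>). So \<open>Q\<close> is a cube, and enlarging some \<open>b i\<close> would
lengthen a vertex, so \<open>P = Q\<close>.\<close>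

section \<open>Dual bases and exchange of a basis vector\<close>

text \<open>A basis of normals is encoded by an enumeration \<open>e\<close> of its indices by the coordinate type. Every basis then
occurs once per ordering, which multiplies all the sums below by the same factor, and exchanging one
element of the basis is the function update \<open>e(a := j)\<close>.\<close>

definition row_matrix :: "('i \<Rightarrow> real^'n) \<Rightarrow> ('n \<Rightarrow> 'i) \<Rightarrow> real^'n^'n" where
  "row_matrix u e = (\<chi> a. u (e a))"

definition dual_vector :: "('i \<Rightarrow> real^'n) \<Rightarrow> ('n \<Rightarrow> 'i) \<Rightarrow> 'n \<Rightarrow> real^'n" where
  "dual_vector u e a = column a (matrix_inv (row_matrix u e))"

text \<open>When the rows form a basis, this is the solution of the equations \<open>u (e a) \<bullet> x = b (e a)\<close>.\<close>

definition vertex :: "('i \<Rightarrow> real^'n) \<Rightarrow> ('i \<Rightarrow> real) \<Rightarrow> ('n \<Rightarrow> 'i) \<Rightarrow> real^'n" where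
  "vertex u b e = (\<Sum>a\<in>UNIV. b (e a) *\<^sub>R dual_vector u e a)"

lemma matrix_inv_cancel:
  fixes A :: "real^'n^'n"
  assumes "det A \<noteq> 0"
  shows "A ** matrix_inv A = mat 1" "matrix_inv A ** A = mat 1"
proof -
  have "\<exists>B. A ** B = mat 1 \<and> B ** A = mat 1"
    using assms by (simp add: invertible_det_nz[symmetric] invertible_def)
  from someI_ex[OF this] show "A ** matrix_inv A = mat 1" "matrix_inv A ** A = mat 1"
    by (simp_all add: matrix_inv_def)
qed

lemma inner_dual_vector:
  assumes "det (row_matrix u e) \<noteq> 0"
  shows "u (e c) \<bullet> dual_vector u e a = (if c = a then 1 else 0)"
proof -
  have "row_matrix u e ** matrix_inv (row_matrix u e) = mat 1"
    using assms by (rule matrix_inv_cancel)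
  then have "(row_matrix u e ** matrix_inv (row_matrix u e)) $ c $ a = (if c = a then 1 else 0)"
    by (simp add: mat_def)
  then show ?thesis
    by (simp add: matrix_matrix_mult_def row_matrix_def dual_vector_def column_def inner_vec_def)
qed

lemma inj_if_det_row_matrix_nonzero:
  assumes "det (row_matrix u e) \<noteq> 0"
  shows "inj e"
proof (rule injI)
  fix a c assume "e a = e c"
  then show "a = c"
    using inner_dual_vector[OF assms, of a a] inner_dual_vector[OF assms, of c a]
    by (metis zero_neq_one)
qed

lemma eq_if_inner_rows_eq:
  assumes d: "det (row_matrix u e) \<noteq> 0" and "\<And>a. u (e a) \<bullet> v = u (e a) \<bullet> w"
  shows "v = w"
proof -
  have "row_matrix u e *v v = row_matrix u e *v w"
    using assms(2) by (simp add: vec_eq_iff matrix_vector_mult_def row_matrix_def inner_vec_def)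
  moreover have "inj ((*v) (row_matrix u e))"
    using d by (simp add: inj_matrix_vector_mult invertible_det_nz)
  ultimately show ?thesis by (auto dest: injD)
qed

lemma inner_vertex:
  assumes "det (row_matrix u e) \<noteq> 0"
  shows "u (e c) \<bullet> vertex u b e = b (e c)"
proof -
  have "b (e a) * (u (e c) \<bullet> dual_vector u e a) = (if c = a then b (e c) else 0)" for a
    by (simp add: inner_dual_vector[OF assms])
  then show ?thesis by (simp add: vertex_def inner_sum_right)
qed

lemma expand_rows:
  assumes d: "det (row_matrix u e) \<noteq> 0"
  shows "v = (\<Sum>c\<in>UNIV. (v \<bullet> dual_vector u e c) *\<^sub>R u (e c))"
proof -
  let ?A = "row_matrix u e" let ?B = "matrix_inv ?A"
  have "?B ** ?A = mat 1" using d by (rule matrix_inv_cancel)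
  then have "transpose ?A *v (transpose ?B *v v) = v"
    by (metis matrix_transpose_mul matrix_vector_mul_assoc matrix_vector_mul_lid transpose_mat)
  then show ?thesis
    by (simp add: vec_eq_iff matrix_vector_mult_def transpose_def row_matrix_def dual_vector_def
        column_def inner_vec_def mult.commute)
qed

lemma sum_inner_rows_dual:
  assumes d: "det (row_matrix u e) \<noteq> 0"
  shows "(\<Sum>a\<in>UNIV. (u (e a) \<bullet> p) * (dual_vector u e a \<bullet> q)) = p \<bullet> q"
proof -
  have "p \<bullet> q = p \<bullet> (\<Sum>c\<in>UNIV. (q \<bullet> dual_vector u e c) *\<^sub>R u (e c))"
    using expand_rows[OF d, of q] by simp
  then show ?thesis by (simp add: inner_sum_right inner_commute mult.commute)
qed

text \<open>Cramer's rule: the coefficient of \<open>u j\<close> at the basis vector \<open>u (e a)\<close> is a quotient of two determinants.\<close>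

lemma det_row_matrix_update:
  assumes d: "det (row_matrix u e) \<noteq> 0"
  shows "det (row_matrix u (e(a := j))) = (u j \<bullet> dual_vector u e a) * det (row_matrix u e)"
proof -
  let ?y = "\<chi> c. u j \<bullet> dual_vector u e c" and ?A = "row_matrix u e"
  have y: "transpose ?A *v ?y = u j"
    by (subst expand_rows[OF d, of "u j"])
       (simp add: vec_eq_iff matrix_vector_mult_def transpose_def row_matrix_def mult.commute)
  have "transpose (row_matrix u (e(a := j))) =
      (\<chi> i l. if l = a then (transpose ?A *v ?y) $ i else transpose ?A $ i $ l)"
    unfolding y by (simp add: vec_eq_iff transpose_def row_matrix_def)
  then have "det (transpose (row_matrix u (e(a := j)))) = ?y $ a * det (transpose ?A)"
    by (simp only: cramer_lemma)
  then show ?thesis by simp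
qed

text \<open>Exchanging the basis element at position \<open>a\<close> keeps the other rows, hence the line orthogonal to them, so the dual vector at
\<open>a\<close> is only rescaled. By \<open>det_row_matrix_update\<close> the scaling factor is exactly inverse to the change of
the determinant, which makes the weighted dual vector an invariant of the edge up to sign.\<close>

lemma dual_vector_update:
  assumes d: "det (row_matrix u e) \<noteq> 0" and s: "u j \<bullet> dual_vector u e a \<noteq> 0"
  shows "dual_vector u (e(a := j)) a = dual_vector u e a /\<^sub>R (u j \<bullet> dual_vector u e a)"
proof -
  have d': "det (row_matrix u (e(a := j))) \<noteq> 0"
    using d s by (simp add: det_row_matrix_update)
  show ?thesis
  proof (rule eq_if_inner_rows_eq[OF d'])
    fix c show "u ((e(a := j)) c) \<bullet> dual_vector u (e(a := j)) a =
       u ((e(a := j)) c) \<bullet> (dual_vector u e a /\<^sub>R (u j \<bullet> dual_vector u e a))"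
      using s by (subst inner_dual_vector[OF d']) (simp add: inner_dual_vector[OF d])
  qed
qed

lemma vertex_update:
  assumes d: "det (row_matrix u e) \<noteq> 0" and s: "u j \<bullet> dual_vector u e a \<noteq> 0"
  shows "vertex u b (e(a := j)) = vertex u b e +
     ((b j - u j \<bullet> vertex u b e) / (u j \<bullet> dual_vector u e a)) *\<^sub>R dual_vector u e a"
proof -
  have d': "det (row_matrix u (e(a := j))) \<noteq> 0"
    using d s by (simp add: det_row_matrix_update)
  show ?thesis
  proof (rule eq_if_inner_rows_eq[OF d'])
    fix c show "u ((e(a := j)) c) \<bullet> vertex u b (e(a := j)) = u ((e(a := j)) c) \<bullet> (vertex u b e +
     ((b j - u j \<bullet> vertex u b e) / (u j \<bullet> dual_vector u e a)) *\<^sub>R dual_vector u e a)"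
      using s by (subst inner_vertex[OF d'])
       (simp add: inner_dual_vector[OF d] inner_vertex[OF d] inner_add_right)
  qed
qed

section \<open>Cancellation along the edges of a simple polytope\<close>

definition polyhedron_of :: "('i \<Rightarrow> 'a::real_inner) \<Rightarrow> ('i \<Rightarrow> real) \<Rightarrow> 'i set \<Rightarrow> 'a set" where
  "polyhedron_of u b I = {x. \<forall>i\<in>I. u i \<bullet> x \<le> b i}"

definition feasible_bases :: "('i \<Rightarrow> real^'n) \<Rightarrow> ('i \<Rightarrow> real) \<Rightarrow> 'i set \<Rightarrow> ('n \<Rightarrow> 'i) set" where
  "feasible_bases u b I = {e. range e \<subseteq> I \<and> det (row_matrix u e) \<noteq> 0 \<and> vertex u b e \<in> polyhedron_of u b I}"

lemma finite_feasible_bases: "finite I \<Longrightarrow> finite (feasible_bases u b I)"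
  by (rule finite_subset[of _ "UNIV \<rightarrow>\<^sub>E I"], force simp: feasible_bases_def)
     (rule finite_PiE, auto)

text \<open>The polyhedron is simple in the strong sense that no vertex, feasible or not, lies on a further bounding
hyperplane.\<close>

definition simple_rhs :: "('i \<Rightarrow> real^'n) \<Rightarrow> ('i \<Rightarrow> real) \<Rightarrow> 'i set \<Rightarrow> bool" where
  "simple_rhs u b I \<longleftrightarrow> (\<forall>e j. range e \<subseteq> I \<longrightarrow> det (row_matrix u e) \<noteq> 0 \<longrightarrow> j \<in> I - range e \<longrightarrow>
      u j \<bullet> vertex u b e \<noteq> b j)"

text \<open>This is the ratio test of the simplex method. Leaving the vertex in direction \<open>- dual_vector u e a\<close> keeps
every equation except the one at \<open>a\<close>. Boundedness stops this ray at a first bounding hyperplane, which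
is unique because two simultaneous ones would meet in a vertex that \<open>simple_rhs\<close> excludes.\<close>

lemma unique_neighbour:
  fixes u :: "'i \<Rightarrow> real^'n"
  assumes fin: "finite I" and bdd: "bounded (polyhedron_of u b I)" and simple: "simple_rhs u b I"
    and e: "e \<in> feasible_bases u b I"
  shows "\<exists>!j. e(a := j) \<in> feasible_bases u b I \<and> u j \<bullet> dual_vector u e a < 0"
proof -
  define x where "x = vertex u b e"
  define f where "f = dual_vector u e a"
  define C where "C = {j\<in>I. u j \<bullet> f < 0}"
  define r where "r j = (b j - u j \<bullet> x) / (- (u j \<bullet> f))" for j
  have d: "det (row_matrix u e) \<noteq> 0" and eI: "range e \<subseteq> I" and xP: "\<And>i. i \<in> I \<Longrightarrow> u i \<bullet> x \<le> b i"
    using e by (auto simp: feasible_bases_def x_def polyhedron_of_def)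
  have f0: "f \<noteq> 0" using inner_dual_vector[OF d, of a a] by (auto simp: f_def)
  have r: "r j * (- (u j \<bullet> f)) = b j - u j \<bullet> x" if "u j \<bullet> f < 0" for j
    using that by (simp add: r_def)
  have r0: "0 \<le> r j" if "j \<in> C" for j
    using that xP[of j] by (auto simp: r_def C_def divide_nonneg_neg)
  have v: "vertex u b (e(a := j)) = x - r j *\<^sub>R f" and d': "det (row_matrix u (e(a := j))) \<noteq> 0"
    if "u j \<bullet> f < 0" for j
    using that d by (auto simp: vertex_update det_row_matrix_update r_def x_def f_def)
  have le: "u i \<bullet> (x - t *\<^sub>R f) \<le> b i" if "i \<in> I" "0 \<le> t" "i \<in> C \<Longrightarrow> t \<le> r i" for i t
  proof (cases "i \<in> C")
    case True
    then have "t * (- (u i \<bullet> f)) \<le> b i - u i \<bullet> x"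
      using that r[of i] mult_right_mono[of t "r i" "- (u i \<bullet> f)"] by (simp add: C_def)
    then show ?thesis by (simp add: inner_diff_right)
  next
    case False
    then have "0 \<le> t * (u i \<bullet> f)" using that by (simp add: C_def)
    then show ?thesis using xP[OF that(1)] by (simp add: inner_diff_right)
  qed
  have ge: "t \<le> r i" if "i \<in> C" "u i \<bullet> (x - t *\<^sub>R f) \<le> b i" for i t
  proof (rule mult_right_le_imp_le)
    show "0 < - (u i \<bullet> f)" using that by (simp add: C_def)
    then show "t * - (u i \<bullet> f) \<le> r i * - (u i \<bullet> f)"
      using that r[of i] by (simp add: inner_diff_right)
  qed
  have "C \<noteq> {}"
  proof
    assume C: "C = {}"
    obtain R where R: "\<And>y. y \<in> polyhedron_of u b I \<Longrightarrow> norm y \<le> R"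
      using bdd by (auto simp: bounded_iff)
    define t where "t = (\<bar>R\<bar> + norm x + 1) / norm f"
    have t0: "0 \<le> t" by (simp add: t_def)
    have "x - t *\<^sub>R f \<in> polyhedron_of u b I"
      using le t0 C by (auto simp: polyhedron_of_def)
    then have "norm (x - t *\<^sub>R f) \<le> R" by (rule R)
    moreover have "norm (t *\<^sub>R f) = \<bar>R\<bar> + norm x + 1" using f0 t0 by (simp add: t_def)
    ultimately show False using norm_triangle_ineq4[of x "x - t *\<^sub>R f"] by simp
  qed
  moreover have "finite C" using fin by (simp add: C_def)
  ultimately obtain j where j: "j \<in> C" "\<And>i. i \<in> C \<Longrightarrow> r j \<le> r i"
    using that[of "arg_min_on r C"] by (simp add: arg_min_if_finite(1) arg_min_least)
  show ?thesis
  proof (rule ex1I)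
    have uj: "u j \<bullet> f < 0" using j by (simp add: C_def)
    have "x - r j *\<^sub>R f \<in> polyhedron_of u b I"
      unfolding polyhedron_of_def using le[OF _ r0[OF j(1)] j(2)] by blast
    moreover have jI: "range (e(a := j)) \<subseteq> I" using eI j(1) by (auto simp: C_def)
    ultimately show "e(a := j) \<in> feasible_bases u b I \<and> u j \<bullet> dual_vector u e a < 0"
      using d'[OF uj] uj by (simp add: feasible_bases_def v[OF uj] f_def)
    fix k assume k: "e(a := k) \<in> feasible_bases u b I \<and> u k \<bullet> dual_vector u e a < 0"
    then have kI: "k \<in> I" and uk: "u k \<bullet> f < 0" by (auto simp: feasible_bases_def f_def)
    then have kC: "k \<in> C" by (simp add: C_def)
    have "u j \<bullet> (x - r k *\<^sub>R f) \<le> b j"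
      using k j v[OF uk] by (auto simp: feasible_bases_def polyhedron_of_def C_def)
    then have "r k = r j" using ge[OF j(1)] j(2)[OF kC] by force
    then have tight: "u k \<bullet> vertex u b (e(a := j)) = b k"
      using r[OF uk] by (simp add: v[OF uj] inner_diff_right)
    have "k \<in> range (e(a := j))"
    proof (rule ccontr)
      assume "k \<notin> range (e(a := j))"
      then have "u k \<bullet> vertex u b (e(a := j)) \<noteq> b k"
        using simple[unfolded simple_rhs_def, rule_format, of "e(a := j)" k] kI d'[OF uj] jI
        by blast
      with tight show False by simp
    qed
    then obtain c where c: "k = (e(a := j)) c" by (rule rangeE)
    show "k = j"
    proof (rule ccontr)
      assume "k \<noteq> j"
      with c have "k = e c" by (auto split: if_splits)
      then have "u k \<bullet> f \<ge> 0" using inner_dual_vector[OF d, of c a] by (auto simp: f_def)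
      with uk show False by simp
    qed
  qed
qed

text \<open>The relation \<open>R\<close> matches the elements of \<open>F\<close> in pairs on which the summands cancel.\<close>

lemma sum_eq_0_if_paired:
  fixes g :: "'a \<Rightarrow> real"
  assumes ex1: "\<And>x. x \<in> F \<Longrightarrow> \<exists>!y. y \<in> F \<and> R x y"
    and sym: "\<And>x y. x \<in> F \<Longrightarrow> y \<in> F \<Longrightarrow> R x y \<Longrightarrow> R y x"
    and neg: "\<And>x y. x \<in> F \<Longrightarrow> y \<in> F \<Longrightarrow> R x y \<Longrightarrow> g y = - g x"
  shows "sum g F = 0"
proof -
  define h where "h x = (THE y. y \<in> F \<and> R x y)" for x
  have h: "h x \<in> F" "R x (h x)" if "x \<in> F" for x
    using theI'[OF ex1[OF that]] by (auto simp: h_def)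
  have hh: "h (h x) = x" if "x \<in> F" for x
    using that h[OF that] h[OF h(1)[OF that]] sym[OF that h(1)[OF that] h(2)[OF that]]
    by (intro the1_equality[OF ex1[OF h(1)[OF that]], folded h_def]) auto
  have "sum g F = (\<Sum>x\<in>F. - g x)"
    by (rule sum.reindex_bij_witness[of F h h]) (auto simp: h hh neg)
  then show ?thesis by (simp add: sum_negf)
qed

text \<open>A flag \<open>(e, a)\<close> is a vertex together with an edge that leaves it. The two ends of an edge have opposite
weighted dual vectors, and \<open>h\<close> takes the same value at both because it ignores the basis
element that is exchanged.\<close>

lemma sum_flags_eq_0:
  fixes u :: "'i \<Rightarrow> real^'n"
  assumes fin: "finite I" and bdd: "bounded (polyhedron_of u b I)" and simple: "simple_rhs u b I"
    and h: "\<And>e a j. h (e(a := j)) a = (h e a :: real)"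
  shows "(\<Sum>e\<in>feasible_bases u b I. \<Sum>a\<in>UNIV.
           \<bar>det (row_matrix u e)\<bar> * (dual_vector u e a \<bullet> q) * h e a) = 0"
proof -
  let ?V = "feasible_bases u b I"
  let ?g = "\<lambda>(e, a). \<bar>det (row_matrix u e)\<bar> * (dual_vector u e a \<bullet> q) * h e a"
  let ?R = "\<lambda>(e, a) (e', a'). a' = a \<and> (\<exists>j. e' = e(a := j) \<and> u j \<bullet> dual_vector u e a < 0)"
  have "sum ?g (?V \<times> UNIV) = 0"
  proof (rule sum_eq_0_if_paired[where R = ?R])
    fix x assume "x \<in> ?V \<times> (UNIV :: 'n set)"
    then obtain e a where x: "x = (e, a)" and e: "e \<in> ?V" by auto
    show "\<exists>!y. y \<in> ?V \<times> UNIV \<and> ?R x y"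
      using unique_neighbour[OF fin bdd simple e, of a] unfolding x by auto
  next
    fix x y assume "x \<in> ?V \<times> (UNIV :: 'n set)" "?R x y"
    then obtain e a j where x: "x = (e, a)" "e \<in> ?V" and y: "y = (e(a := j), a)"
      and s: "u j \<bullet> dual_vector u e a < 0" by auto
    have d: "det (row_matrix u e) \<noteq> 0" using x by (simp add: feasible_bases_def)
    have dv: "dual_vector u (e(a := j)) a = dual_vector u e a /\<^sub>R (u j \<bullet> dual_vector u e a)"
      using dual_vector_update[OF d] s by force
    have "u (e a) \<bullet> dual_vector u (e(a := j)) a < 0"
      using s by (simp add: dv inner_dual_vector[OF d])
    then show "?R y x" unfolding x y by (auto intro!: exI[of _ "e a"])
    show "?g y = - ?g x"
      using s unfolding x y
      by (simp add: dv det_row_matrix_update[OF d] h abs_mult field_simps)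
  qed
  then show ?thesis by (simp add: sum.cartesian_product)
qed

text \<open>The feasible bases are those for \<open>b\<close>, but the points are the vertices for the right-hand side \<open>1\<close>: only
for a constant right-hand side is the vertex the plain sum of the dual vectors, as the cancellation
requires.\<close>

lemma sum_weighted_vertices:
  fixes u :: "'i \<Rightarrow> real^'n"
  assumes fin: "finite I" and bdd: "bounded (polyhedron_of u b I)" and simple: "simple_rhs u b I"
  shows "(\<Sum>e\<in>feasible_bases u b I. \<bar>det (row_matrix u e)\<bar> * (vertex u (\<lambda>_. 1) e \<bullet> q)) = 0"
    and "(\<Sum>e\<in>feasible_bases u b I. \<bar>det (row_matrix u e)\<bar> *
            (\<Sum>c\<in>UNIV. (u (e c) \<bullet> p) * (vertex u (\<lambda>_. 1) e \<bullet> q))) =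
         (\<Sum>e\<in>feasible_bases u b I. \<bar>det (row_matrix u e)\<bar>) * (p \<bullet> q)"
proof -
  let ?V = "feasible_bases u b I" and ?w = "\<lambda>e. \<bar>det (row_matrix u e)\<bar>"
  have X: "vertex u (\<lambda>_. 1) e \<bullet> q = (\<Sum>a\<in>UNIV. dual_vector u e a \<bullet> q)" for e
    by (simp add: vertex_def inner_sum_left)
  show "(\<Sum>e\<in>?V. ?w e * (vertex u (\<lambda>_. 1) e \<bullet> q)) = 0"
    using sum_flags_eq_0[OF fin bdd simple, of "\<lambda>_ _. 1" q] by (simp add: X sum_distrib_left)
  let ?h = "\<lambda>e a. \<Sum>c\<in>UNIV - {a}. u (e c) \<bullet> p"
  have h: "?h (e(a := j)) a = ?h e a" for e a j
    by (rule sum.cong) auto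
  have "?w e * (\<Sum>c\<in>UNIV. (u (e c) \<bullet> p) * (vertex u (\<lambda>_. 1) e \<bullet> q)) =
      (\<Sum>a\<in>UNIV. ?w e * (dual_vector u e a \<bullet> q) * ?h e a) + ?w e * (p \<bullet> q)" if "e \<in> ?V" for e
  proof -
    have d: "det (row_matrix u e) \<noteq> 0" using that by (simp add: feasible_bases_def)
    have "(\<Sum>c\<in>UNIV. (u (e c) \<bullet> p) * (vertex u (\<lambda>_. 1) e \<bullet> q)) =
        (\<Sum>a\<in>UNIV. (dual_vector u e a \<bullet> q) * (\<Sum>c\<in>UNIV. u (e c) \<bullet> p))"
      unfolding X sum_distrib_left by (subst sum.swap) (simp add: mult.commute)
    also have "\<dots> = (\<Sum>a\<in>UNIV. (dual_vector u e a \<bullet> q) * ?h e a + (u (e a) \<bullet> p) * (dual_vector u e a \<bullet> q))"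
    proof (intro sum.cong refl)
      fix a
      have "(\<Sum>c\<in>UNIV. u (e c) \<bullet> p) = u (e a) \<bullet> p + ?h e a" by (rule sum.remove) auto
      then show "(dual_vector u e a \<bullet> q) * (\<Sum>c\<in>UNIV. u (e c) \<bullet> p) =
          (dual_vector u e a \<bullet> q) * ?h e a + (u (e a) \<bullet> p) * (dual_vector u e a \<bullet> q)"
        by (simp add: algebra_simps)
    qed
    also have "\<dots> = (\<Sum>a\<in>UNIV. (dual_vector u e a \<bullet> q) * ?h e a) + p \<bullet> q"
      by (simp add: sum.distrib sum_inner_rows_dual[OF d])
    finally show ?thesis by (simp add: sum_distrib_left distrib_left mult.assoc)
  qed
  then show "(\<Sum>e\<in>?V. ?w e * (\<Sum>c\<in>UNIV. (u (e c) \<bullet> p) * (vertex u (\<lambda>_. 1) e \<bullet> q))) =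
         (\<Sum>e\<in>?V. ?w e) * (p \<bullet> q)"
    using sum_flags_eq_0[OF fin bdd simple, of ?h q, OF h]
    by (simp add: sum.distrib sum_distrib_right)
qed

section \<open>The determinant measure on the vertices\<close>

lemma eventually_poly_nonzero:
  fixes p :: "real poly"
  assumes "p \<noteq> 0"
  shows "\<forall>\<^sub>F x in at_right a. poly p x \<noteq> 0"
  using islimpt_finite[OF poly_roots_finite[OF assms], of a]
  by (simp add: islimpt_iff_eventually eventually_at_split)

text \<open>With \<open>b i = 1 + \<epsilon> ^ Suc i\<close>, the values of \<open>\<epsilon>\<close> at which a vertex becomes degenerate are
roots of a nonzero polynomial, so small positive \<open>\<epsilon>\<close> avoid all of them. Strict violation of an inequality is stable under a small perturbation, so a basis that is feasible
after the perturbation was feasible before.\<close>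

lemma exists_simple_rhs:
  fixes u :: "nat \<Rightarrow> real^'n"
  assumes fin: "finite I"
  shows "\<exists>b. simple_rhs u b I \<and> (\<forall>i\<in>I. 0 < b i \<and> b i \<le> 2) \<and>
           (\<forall>e\<in>feasible_bases u b I. vertex u (\<lambda>_. 1) e \<in> polyhedron_of u (\<lambda>_. 1) I)"
proof -
  define b :: "real \<Rightarrow> nat \<Rightarrow> real" where "b \<epsilon> i = 1 + \<epsilon> ^ Suc i" for \<epsilon> i
  define F where "F = {e :: 'n \<Rightarrow> nat. range e \<subseteq> I}"
  have finF: "finite F"
    by (rule finite_subset[of _ "UNIV \<rightarrow>\<^sub>E I"], force simp: F_def) (rule finite_PiE, auto simp: fin)
  have 1: "\<forall>\<^sub>F \<epsilon> in at_right 0. u j \<bullet> vertex u (b \<epsilon>) e \<noteq> b \<epsilon> j" if "j \<notin> range e" for e :: "'n \<Rightarrow> nat" and j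
  proof -
    define p where "p = ([:1:] + monom 1 (Suc j)) -
      (\<Sum>a\<in>UNIV. smult (u j \<bullet> dual_vector u e a) ([:1:] + monom 1 (Suc (e a))))"
    have poly: "poly p \<epsilon> = b \<epsilon> j - u j \<bullet> vertex u (b \<epsilon>) e" for \<epsilon>
      by (simp add: p_def b_def vertex_def poly_sum poly_monom inner_sum_right mult.commute)
    \<comment> \<open>Only the constraint \<open>j\<close> itself contributes to the monomial of exponent \<open>Suc j\<close>.\<close>
    have "coeff p (Suc j) = 1"
      using that by (auto simp: p_def coeff_sum coeff_pCons image_iff intro!: sum.neutral)
    then have "p \<noteq> 0" by auto
    from eventually_poly_nonzero[OF this] show ?thesis
      by (rule eventually_mono) (auto simp: poly)
  qed
  have "\<forall>\<^sub>F \<epsilon> in at_right 0. \<forall>e\<in>F. \<forall>j\<in>I. j \<notin> range e \<longrightarrow> u j \<bullet> vertex u (b \<epsilon>) e \<noteq> b \<epsilon> j"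
    using 1 by (intro eventually_ball_finite finF fin ballI) (simp add: eventually_mono)
  moreover have "\<forall>\<^sub>F \<epsilon> in at_right 0. \<forall>e\<in>F. \<forall>i\<in>I. 1 < u i \<bullet> vertex u (\<lambda>_. 1) e \<longrightarrow> b \<epsilon> i < u i \<bullet> vertex u (b \<epsilon>) e"
  proof (intro eventually_ball_finite finF fin ballI)
    fix e :: "'n \<Rightarrow> nat" and i
    have lim: "((\<lambda>\<epsilon>. u i \<bullet> vertex u (b \<epsilon>) e - b \<epsilon> i) \<longlongrightarrow> u i \<bullet> vertex u (\<lambda>_. 1) e - 1) (at_right 0)"
      unfolding vertex_def b_def by (rule tendsto_eq_intros refl | simp)+
    show "\<forall>\<^sub>F \<epsilon> in at_right 0. 1 < u i \<bullet> vertex u (\<lambda>_. 1) e \<longrightarrow> b \<epsilon> i < u i \<bullet> vertex u (b \<epsilon>) e"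
    proof (cases "1 < u i \<bullet> vertex u (\<lambda>_. 1) e")
      case True
      then show ?thesis
        using order_tendstoD(1)[OF lim, of 0] by (auto elim: eventually_mono)
    qed simp
  qed
  moreover have "\<forall>\<^sub>F \<epsilon> in at_right 0. (0::real) < \<epsilon> \<and> \<epsilon> < 1"
    using eventually_at_right_real[of 0 1] by (auto elim: eventually_mono)
  ultimately have "\<forall>\<^sub>F \<epsilon> in at_right 0. (\<forall>e\<in>F. \<forall>j\<in>I. j \<notin> range e \<longrightarrow> u j \<bullet> vertex u (b \<epsilon>) e \<noteq> b \<epsilon> j) \<and>
      (\<forall>e\<in>F. \<forall>i\<in>I. 1 < u i \<bullet> vertex u (\<lambda>_. 1) e \<longrightarrow> b \<epsilon> i < u i \<bullet> vertex u (b \<epsilon>) e) \<and> 0 < \<epsilon> \<and> \<epsilon> < 1"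
    by eventually_elim blast
  then obtain \<epsilon> where \<epsilon>: "\<forall>e\<in>F. \<forall>j\<in>I. j \<notin> range e \<longrightarrow> u j \<bullet> vertex u (b \<epsilon>) e \<noteq> b \<epsilon> j"
      "\<forall>e\<in>F. \<forall>i\<in>I. 1 < u i \<bullet> vertex u (\<lambda>_. 1) e \<longrightarrow> b \<epsilon> i < u i \<bullet> vertex u (b \<epsilon>) e" "0 < \<epsilon>" "\<epsilon> < 1"
    using eventually_happens'[OF trivial_limit_at_right_real] by blast
  have "simple_rhs u (b \<epsilon>) I"
    using \<epsilon>(1) by (auto simp: simple_rhs_def F_def)
  moreover have "0 < b \<epsilon> i \<and> b \<epsilon> i \<le> 2" for i
  proof -
    have "\<epsilon> ^ Suc i \<le> 1" "0 < \<epsilon> ^ Suc i" using \<epsilon>(3,4) by (intro power_le_one zero_less_power; simp)+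
    then show ?thesis unfolding b_def by linarith
  qed
  moreover have "vertex u (\<lambda>_. 1) e \<in> polyhedron_of u (\<lambda>_. 1) I" if "e \<in> feasible_bases u (b \<epsilon>) I" for e
    unfolding polyhedron_of_def
  proof safe
    fix i assume "i \<in> I"
    then have "u i \<bullet> vertex u (b \<epsilon>) e \<le> b \<epsilon> i" "e \<in> F"
      using that by (auto simp: feasible_bases_def polyhedron_of_def F_def)
    then show "u i \<bullet> vertex u (\<lambda>_. 1) e \<le> 1"
      using \<epsilon>(2) \<open>i \<in> I\<close> by (meson linorder_not_le)
  qed
  ultimately show ?thesis by blast
qed

text \<open>A longest point of the polytope is a vertex: if the tight normals did not span, one could move in both
directions \<open>v\<close> and \<open>- v\<close> orthogonal to them, and one of the two moves increases the norm.\<close>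

lemma feasible_bases_nonempty:
  fixes u :: "'i \<Rightarrow> real^'n"
  assumes fin: "finite I" and bdd: "bounded (polyhedron_of u b I)" and pos: "\<And>i. i \<in> I \<Longrightarrow> 0 < b i"
  shows "feasible_bases u b I \<noteq> {}"
proof -
  let ?P = "polyhedron_of u b I"
  have "?P = (\<Inter>i\<in>I. {x. u i \<bullet> x \<le> b i})" by (auto simp: polyhedron_of_def)
  then have "compact ?P"
    using bdd by (simp add: compact_eq_bounded_closed closed_INT closed_halfspace_le)
  moreover have "0 \<in> ?P" using pos by (simp add: polyhedron_of_def less_imp_le)
  ultimately obtain x where xP: "x \<in> ?P" and max: "\<And>y. y \<in> ?P \<Longrightarrow> norm y \<le> norm x"
    using continuous_attains_sup[of ?P norm] continuous_on_norm_id by blast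
  define J where "J = {i \<in> I. u i \<bullet> x = b i}"
  have span: "span (u ` J) = UNIV"
  proof (rule ccontr)
    assume "span (u ` J) \<noteq> UNIV"
    then obtain v where v0: "v \<noteq> 0" and v: "\<And>i. i \<in> J \<Longrightarrow> u i \<bullet> v = 0"
      using span_not_UNIV_orthogonal span_base by (metis image_eqI inner_commute)
    have ev: "\<forall>\<^sub>F t in at_right 0. \<forall>i\<in>I. u i \<bullet> (x + t *\<^sub>R w) \<le> b i" if w: "\<And>i. i \<in> J \<Longrightarrow> u i \<bullet> w = 0" for w
    proof (intro eventually_ball_finite fin ballI)
      fix i assume i: "i \<in> I"
      show "\<forall>\<^sub>F t in at_right 0. u i \<bullet> (x + t *\<^sub>R w) \<le> b i"
      proof (cases "i \<in> J")
        case True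
        then show ?thesis using w by (simp add: inner_add_right J_def)
      next
        case False
        then have "u i \<bullet> x < b i" using i xP by (auto simp: J_def polyhedron_of_def le_less)
        moreover have "((\<lambda>t. u i \<bullet> (x + t *\<^sub>R w)) \<longlongrightarrow> u i \<bullet> x) (at_right 0)"
          by (rule tendsto_eq_intros refl | simp)+
        ultimately show ?thesis
          using order_tendstoD(2) by (fastforce elim: eventually_mono)
      qed
    qed
    have "\<forall>\<^sub>F t in at_right (0::real). 0 < t" by (simp add: eventually_at_right_less)
    moreover have "\<forall>\<^sub>F t in at_right 0. \<forall>i\<in>I. u i \<bullet> (x + t *\<^sub>R v) \<le> b i"
      by (rule ev) (rule v)
    moreover have "\<forall>\<^sub>F t in at_right 0. \<forall>i\<in>I. u i \<bullet> (x + t *\<^sub>R (- v)) \<le> b i"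
      by (rule ev) (simp add: v)
    ultimately have "\<forall>\<^sub>F t in at_right (0::real). 0 < t \<and> x + t *\<^sub>R v \<in> ?P \<and> x + t *\<^sub>R (- v) \<in> ?P"
      by eventually_elim (simp add: polyhedron_of_def)
    then obtain t :: real where t: "0 < t" "x + t *\<^sub>R v \<in> ?P" "x + t *\<^sub>R (- v) \<in> ?P"
      using eventually_happens'[OF trivial_limit_at_right_real] by blast
    have "(norm (x + t *\<^sub>R v))\<^sup>2 \<le> (norm x)\<^sup>2" "(norm (x + t *\<^sub>R (- v)))\<^sup>2 \<le> (norm x)\<^sup>2"
      using t max by (simp_all add: power_mono)
    then have "t * t * (v \<bullet> v) \<le> 0"
      by (simp add: power2_norm_eq_inner inner_simps inner_commute)
    moreover have "0 < t * t * (v \<bullet> v)" using t v0 by simp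
    ultimately show False by linarith
  qed
  obtain B where B: "B \<subseteq> u ` J" "independent B" "u ` J \<subseteq> span B" "card B = dim (u ` J)"
    using basis_exists by blast
  have spanB: "span B = UNIV" using span B(3) span_minimal[OF B(3) subspace_span] by auto
  have "card B = CARD('n)" using B(4) span by (simp add: dim_eq_full[symmetric])
  moreover have "finite B" using B(2) by (simp add: independent_imp_finite)
  ultimately obtain h :: "'n \<Rightarrow> real^'n" where h: "bij_betw h UNIV B"
    using finite_same_card_bij[of "UNIV :: 'n set" B] by auto
  have hJ: "h a \<in> u ` J" for a
    using subsetD[OF B(1) bij_betw_apply[OF h UNIV_I]] .
  define e where "e a = inv_into J u (h a)" for a
  have e: "e a \<in> J" "u (e a) = h a" for a
    using inv_into_into[OF hJ] f_inv_into_f[OF hJ] by (simp_all add: e_def)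
  have "rows (row_matrix u e) = B"
    using bij_betw_imp_surj_on[OF h] by (simp add: rows_def row_def row_matrix_def e full_SetCompr_eq)
  then have d: "det (row_matrix u e) \<noteq> 0"
    using spanB by (metis matrix_left_invertible_span_rows invertible_left_inverse invertible_det_nz)
  have "vertex u b e = x"
    by (rule eq_if_inner_rows_eq[OF d]) (use e(1) in \<open>simp add: inner_vertex[OF d] J_def\<close>)
  then have "e \<in> feasible_bases u b I"
    using e xP d by (auto simp: feasible_bases_def J_def)
  then show ?thesis by blast
qed

text \<open>The perturbed vertices enter only through the set of bases \<open>V\<close>; the identities hold exactly for the
unperturbed vertices.\<close>

lemma exists_vertex_measure:
  fixes u :: "nat \<Rightarrow> real^'n"
  assumes fin: "finite I" and bdd: "bounded (polyhedron_of u (\<lambda>_. 1) I)"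
  obtains V w where "finite V"
    "\<And>e. e \<in> V \<Longrightarrow> range e \<subseteq> I" "\<And>e. e \<in> V \<Longrightarrow> det (row_matrix u e) \<noteq> 0"
    "\<And>e. e \<in> V \<Longrightarrow> vertex u (\<lambda>_. 1) e \<in> polyhedron_of u (\<lambda>_. 1) I" "\<And>e. e \<in> V \<Longrightarrow> 0 < w e"
    "sum w V = 1"
    "\<And>q. (\<Sum>e\<in>V. w e * (vertex u (\<lambda>_. 1) e \<bullet> q)) = 0"
    "\<And>p q. (\<Sum>e\<in>V. w e * (\<Sum>a\<in>UNIV. (u (e a) \<bullet> p) * (vertex u (\<lambda>_. 1) e \<bullet> q))) = p \<bullet> q"
proof -
  obtain b where b: "simple_rhs u b I" "\<And>i. i \<in> I \<Longrightarrow> 0 < b i" "\<And>i. i \<in> I \<Longrightarrow> b i \<le> 2"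
     "\<And>e. e \<in> feasible_bases u b I \<Longrightarrow> vertex u (\<lambda>_. 1) e \<in> polyhedron_of u (\<lambda>_. 1) I"
    using exists_simple_rhs[OF fin, of u] by blast
  \<comment> \<open>The bound \<open>b i \<le> 2\<close> keeps the perturbed polytope inside a dilate of the original one.\<close>
  have "polyhedron_of u b I \<subseteq> (*\<^sub>R) 2 ` polyhedron_of u (\<lambda>_. 1) I"
  proof
    fix x assume "x \<in> polyhedron_of u b I"
    then have "u i \<bullet> x \<le> 2" if "i \<in> I" for i using b(3)[OF that] that by (force simp: polyhedron_of_def)
    then have "(1/2) *\<^sub>R x \<in> polyhedron_of u (\<lambda>_. 1) I" by (simp add: polyhedron_of_def)
    then show "x \<in> (*\<^sub>R) 2 ` polyhedron_of u (\<lambda>_. 1) I"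
      by (rule rev_image_eqI) simp
  qed
  then have bddb: "bounded (polyhedron_of u b I)"
    using bounded_scaling[OF bdd] bounded_subset by blast
  let ?V = "feasible_bases u b I" and ?d = "\<lambda>e. \<bar>det (row_matrix u e)\<bar>"
  let ?W = "sum ?d ?V"
  have finV: "finite ?V" by (rule finite_feasible_bases[OF fin])
  have dpos: "0 < ?d e" if "e \<in> ?V" for e using that by (simp add: feasible_bases_def)
  then have W: "0 < ?W" using finV feasible_bases_nonempty[OF fin bddb b(2)] by (intro sum_pos) auto
  show ?thesis
  proof (rule that[of ?V "\<lambda>e. ?d e / ?W"])
    show "(\<Sum>e\<in>?V. ?d e / ?W) = 1" using W by (simp add: sum_divide_distrib[symmetric])
    show "(\<Sum>e\<in>?V. ?d e / ?W * (vertex u (\<lambda>_. 1) e \<bullet> q)) = 0" for q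
      using sum_weighted_vertices(1)[OF fin bddb b(1), of q]
      by (simp add: sum_divide_distrib[symmetric])
    show "(\<Sum>e\<in>?V. ?d e / ?W * (\<Sum>a\<in>UNIV. (u (e a) \<bullet> p) * (vertex u (\<lambda>_. 1) e \<bullet> q))) = p \<bullet> q" for p q
      using sum_weighted_vertices(2)[OF fin bddb b(1), of p q] W
      by (simp add: sum_divide_distrib[symmetric])
  qed (use finV b(4) dpos W in \<open>auto simp: feasible_bases_def\<close>)
qed

section \<open>Principal axes\<close>

text \<open>The spectral theorem in the form of simultaneous orthogonality. A maximiser \<open>v\<close> of the Rayleigh quotient
satisfies \<open>f v \<bullet> w = 0\<close> for all \<open>w\<close> orthogonal to \<open>v\<close>, as otherwise a small step in direction \<open>w\<close> would increase the
quotient; the induction continues in the orthogonal complement of \<open>v\<close>.\<close>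

lemma diagonalizing_orthonormal_basis:
  fixes f :: "'a::euclidean_space \<Rightarrow> 'a"
  assumes lin: "linear f" and sa: "\<And>x y. f x \<bullet> y = x \<bullet> f y" and "subspace S"
  shows "\<exists>B. finite B \<and> pairwise orthogonal B \<and> (\<forall>b\<in>B. norm b = 1) \<and> span B = S \<and>
           (\<forall>b\<in>B. \<forall>c\<in>B. b \<noteq> c \<longrightarrow> f b \<bullet> c = 0)"
  using \<open>subspace S\<close>
proof (induction "dim S" arbitrary: S rule: less_induct)
  case less
  show ?case
  proof (cases "S = {0}")
    case True
    then show ?thesis by (intro exI[of _ "{}"]) auto
  next
    case False
    interpret f: linear f by (rule lin)
    let ?K = "S \<inter> sphere 0 1"
    obtain s where "s \<in> S" "s \<noteq> 0" using False subspace_0[OF less.prems] by blast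
    then have "s /\<^sub>R norm s \<in> ?K" using less.prems by (simp add: subspace_scale)
    moreover have "compact ?K" by (simp add: closed_subspace[OF less.prems] closed_Int_compact)
    moreover have "continuous_on ?K (\<lambda>x. x \<bullet> f x)"
      by (intro continuous_intros linear_continuous_on linear_conv_bounded_linear[THEN iffD1] lin)
    ultimately obtain v where v: "v \<in> ?K" "\<And>x. x \<in> ?K \<Longrightarrow> x \<bullet> f x \<le> v \<bullet> f v"
      using continuous_attains_sup[of ?K "\<lambda>x. x \<bullet> f x"] by blast
    have vS: "v \<in> S" and v1: "v \<bullet> v = 1" using v by (auto simp: norm_eq_1)
    define m where "m = v \<bullet> f v"
    have max: "x \<bullet> f x \<le> m * (x \<bullet> x)" if "x \<in> S" for x
    proof (cases "x = 0")
      case False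
      then have "x /\<^sub>R norm x \<in> ?K" using less.prems that by (simp add: subspace_scale)
      then have "(x /\<^sub>R norm x) \<bullet> f (x /\<^sub>R norm x) \<le> m" unfolding m_def by (rule v)
      then have "(x \<bullet> f x) / (norm x)\<^sup>2 \<le> m" by (simp add: f.scaleR power2_eq_square divide_inverse mult_ac)
      then show ?thesis using False by (simp add: divide_le_eq power2_norm_eq_inner)
    qed simp
    have ortho: "f v \<bullet> w = 0" if w: "w \<in> S" "v \<bullet> w = 0" for w
    proof (rule ccontr)
      assume nz: "f v \<bullet> w \<noteq> 0"
      define c where "c = m * (w \<bullet> w) - w \<bullet> f w"
      have ineq: "2 * t * (f v \<bullet> w) \<le> t * t * c" for t
      proof -
        have "v + t *\<^sub>R w \<in> S" using vS w less.prems by (simp add: subspace_add subspace_scale)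
        from max[OF this] have "m + 2 * t * (f v \<bullet> w) + t * t * (w \<bullet> f w) \<le> m * (1 + t * t * (w \<bullet> w))"
          using sa[of v w] by (simp add: f.add f.scaleR inner_simps inner_commute v1 w(2) m_def algebra_simps)
        then show ?thesis by (simp add: c_def algebra_simps)
      qed
      \<comment> \<open>The quadratic term is at most half of the linear term for this step length.\<close>
      define t where "t = (f v \<bullet> w) / (\<bar>c\<bar> + 1)"
      have "2 * (f v \<bullet> w)\<^sup>2 / (\<bar>c\<bar> + 1) \<le> (f v \<bullet> w)\<^sup>2 / (\<bar>c\<bar> + 1) * (c / (\<bar>c\<bar> + 1))"
        using ineq[of t] by (simp add: t_def power2_eq_square)
      also have "\<dots> \<le> (f v \<bullet> w)\<^sup>2 / (\<bar>c\<bar> + 1) * 1"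
        by (intro mult_left_mono) (auto simp: divide_le_eq)
      finally have "(f v \<bullet> w)\<^sup>2 / (\<bar>c\<bar> + 1) \<le> 0" by simp
      moreover have "0 < (f v \<bullet> w)\<^sup>2 / (\<bar>c\<bar> + 1)" using nz by (intro divide_pos_pos) auto
      ultimately show False by linarith
    qed
    define S' where "S' = {w \<in> S. v \<bullet> w = 0}"
    have S': "subspace S'"
      using less.prems by (auto simp: S'_def subspace_def inner_simps)
    have "v \<notin> S'" using v1 by (simp add: S'_def)
    moreover have "S' \<subseteq> S" by (auto simp: S'_def)
    ultimately have "S' \<subset> S" using vS by blast
    then have "dim S' < dim S"
      using S' less.prems by (intro dim_psubset) (simp add: span_eq_iff[THEN iffD2])
    from less.hyps[OF this S'] obtain B where B: "finite B" "pairwise orthogonal B" "\<forall>b\<in>B. norm b = 1"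
      "span B = S'" "\<forall>b\<in>B. \<forall>c\<in>B. b \<noteq> c \<longrightarrow> f b \<bullet> c = 0" by blast
    have BS': "b \<in> S \<and> v \<bullet> b = 0" if "b \<in> B" for b using that B(4) span_base[of b B] by (auto simp: S'_def)
    have "span (insert v B) = S"
    proof
      show "span (insert v B) \<subseteq> S" using vS BS' less.prems by (intro span_minimal) auto
      show "S \<subseteq> span (insert v B)"
      proof
        fix x assume "x \<in> S"
        then have "x - (v \<bullet> x) *\<^sub>R v \<in> S'"
          using less.prems vS v1 by (simp add: S'_def subspace_diff subspace_scale inner_diff_right)
        then show "x \<in> span (insert v B)" using B(4) span_breakdown_eq by blast
      qed
    qed
    moreover have "f b \<bullet> c = 0" if "b \<in> insert v B" "c \<in> insert v B" "b \<noteq> c" for b c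
      using that ortho BS' B(5) sa by (metis inner_commute insert_iff)
    moreover have "pairwise orthogonal (insert v B)"
      using B(2) BS' by (auto simp: pairwise_insert orthogonal_def inner_commute)
    moreover have "norm v = 1" using v1 by (simp add: norm_eq_1)
    ultimately show ?thesis using B(1,3) by (intro exI[of _ "insert v B"]) auto
  qed
qed

lemma inner_orthonormal_basis:
  fixes B :: "'a::euclidean_space set"
  assumes "finite B" "pairwise orthogonal B" "\<And>b. b \<in> B \<Longrightarrow> norm b = 1" "span B = UNIV"
  shows "(\<Sum>b\<in>B. (x \<bullet> b) * (y \<bullet> b)) = x \<bullet> y"
proof -
  have "x \<bullet> y = (\<Sum>b\<in>B. (x \<bullet> b) *\<^sub>R b) \<bullet> y"
    using orthonormal_basis_expand[OF assms(2,3), of x] assms(1,4) by simp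
  then show ?thesis by (simp add: inner_sum_left inner_commute[of y])
qed

section \<open>The second moment of a balanced measure\<close>

text \<open>A random point \<open>X\<close> with a random set \<open>S\<close> of half of the indices, subject to the two moment identities of
a random vertex.\<close>

locale balanced_measure =
  fixes I :: "'i set" and u :: "'i \<Rightarrow> 'a::euclidean_space"
    and V :: "'v set" and w :: "'v \<Rightarrow> real" and S :: "'v \<Rightarrow> 'i set" and X :: "'v \<Rightarrow> 'a"
  assumes finite_I: "finite I" and card_I: "card I = 2 * DIM('a)"
    and unit: "i \<in> I \<Longrightarrow> norm (u i) = 1"
    and finite_V: "finite V" and w_pos: "e \<in> V \<Longrightarrow> 0 < w e" and w_sum: "sum w V = 1"
    and S_subset: "e \<in> V \<Longrightarrow> S e \<subseteq> I" and card_S: "e \<in> V \<Longrightarrow> card (S e) = DIM('a)"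
    and centred: "(\<Sum>e\<in>V. w e * (X e \<bullet> q)) = 0"
    and dual: "(\<Sum>e\<in>V. w e * (\<Sum>i\<in>S e. (u i \<bullet> p) * (X e \<bullet> q))) = p \<bullet> q"
begin

definition expect :: "('v \<Rightarrow> real) \<Rightarrow> real" where
  "expect g = (\<Sum>e\<in>V. w e * g e)"

definition tight :: "'i \<Rightarrow> 'v \<Rightarrow> real" where
  "tight i e = of_bool (i \<in> S e)"

definition prob :: "'i \<Rightarrow> real" where
  "prob i = expect (tight i)"

lemma expect_add: "expect (\<lambda>e. g e + h e) = expect g + expect h"
  and expect_diff: "expect (\<lambda>e. g e - h e) = expect g - expect h"
  and expect_cmult: "expect (\<lambda>e. c * g e) = c * expect g"
  and expect_sum: "expect (\<lambda>e. \<Sum>x\<in>A. G x e) = (\<Sum>x\<in>A. expect (G x))"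
  and expect_const: "expect (\<lambda>e. c) = c"
      apply (simp_all add: expect_def distrib_left right_diff_distrib sum.distrib sum_subtractf
        sum_distrib_left mult.left_commute sum_distrib_right[symmetric] w_sum)
  by (rule sum.swap)

lemma expect_cong: "(\<And>e. e \<in> V \<Longrightarrow> g e = h e) \<Longrightarrow> expect g = expect h"
  by (simp add: expect_def)

lemma expect_mono: "(\<And>e. e \<in> V \<Longrightarrow> g e \<le> h e) \<Longrightarrow> expect g \<le> expect h"
  by (auto simp: expect_def intro!: sum_mono mult_left_mono less_imp_le[OF w_pos])

lemma expect_nonneg: "(\<And>e. e \<in> V \<Longrightarrow> 0 \<le> g e) \<Longrightarrow> 0 \<le> expect g"
  using expect_mono[of "\<lambda>_. 0" g] by (simp add: expect_const)

lemma expect_eq_0D: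
  assumes "expect g = 0" "\<And>e. e \<in> V \<Longrightarrow> 0 \<le> g e" "e \<in> V"
  shows "g e = 0"
proof -
  have "w e * g e = 0"
    using assms w_pos finite_V unfolding expect_def
    by (subst (asm) sum_nonneg_eq_0_iff) (auto intro: less_imp_le mult_nonneg_nonneg)
  then show ?thesis using w_pos[OF assms(3)] by simp
qed

lemma expect_inner: "expect (\<lambda>e. X e \<bullet> q) = 0"
  using centred by (simp add: expect_def)

lemma sum_tight: "e \<in> V \<Longrightarrow> (\<Sum>i\<in>I. tight i e * g i) = sum g (S e)"
  using sum.mono_neutral_cong_right[OF finite_I S_subset, of e "\<lambda>i. tight i e * g i" g]
  by (simp add: tight_def)

lemma sum_prob: "(\<Sum>i\<in>I. prob i) = real DIM('a)"
proof -
  have "(\<Sum>i\<in>I. prob i) = expect (\<lambda>e. \<Sum>i\<in>I. tight i e * 1)"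
    by (simp add: prob_def expect_sum)
  also have "\<dots> = expect (\<lambda>e. real DIM('a))"
    by (rule expect_cong) (simp add: sum_tight card_S del: mult_1_right)
  finally show ?thesis by (simp add: expect_const)
qed

lemma prob_le_1: "prob i \<le> 1"
  using expect_mono[of "tight i" "\<lambda>_. 1"] by (simp add: prob_def expect_const tight_def)

text \<open>Multiplied by \<open>1 - prob i\<close>, this is the mean square error of predicting \<open>tight i\<close> by
\<open>prob i + (1 - prob i) * L\<close>, for a centred \<open>L\<close>.\<close>

definition residual :: "'i \<Rightarrow> ('v \<Rightarrow> real) \<Rightarrow> real" where
  "residual i L = prob i - 2 * expect (\<lambda>e. tight i e * L e) + (1 - prob i) * expect (\<lambda>e. (L e)\<^sup>2)"

lemma expect_residual_sq:
  assumes "expect L = 0"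
  shows "expect (\<lambda>e. (tight i e - prob i - (1 - prob i) * L e)\<^sup>2) =
     (1 - prob i) * residual i L"
proof -
  let ?p = "prob i"
  have "(tight i e - ?p - (1 - ?p) * L e)\<^sup>2 = (1 - 2 * ?p) * tight i e + ?p\<^sup>2
      + 2 * ?p * (1 - ?p) * L e - 2 * (1 - ?p) * (tight i e * L e) + (1 - ?p)\<^sup>2 * (L e)\<^sup>2" for e
    by (cases "i \<in> S e") (simp_all add: tight_def power2_eq_square algebra_simps)
  then have "expect (\<lambda>e. (tight i e - ?p - (1 - ?p) * L e)\<^sup>2) = (1 - 2 * ?p) * ?p + ?p\<^sup>2
      + 2 * ?p * (1 - ?p) * expect L - 2 * (1 - ?p) * expect (\<lambda>e. tight i e * L e)
      + (1 - ?p)\<^sup>2 * expect (\<lambda>e. (L e)\<^sup>2)"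
    by (simp only: expect_add expect_diff expect_cmult expect_const prob_def[symmetric])
  then show ?thesis using assms by (simp add: residual_def power2_eq_square algebra_simps)
qed

text \<open>If \<open>prob i < 1\<close>, the factor \<open>1 - prob i\<close> can be cancelled from the mean square error. If \<open>prob i = 1\<close>, the
index is always tight and the residual equals \<open>1\<close>.\<close>

lemma residual_nonneg:
  assumes L: "expect L = 0"
  shows "0 \<le> residual i L"
    and "residual i L = 0 \<Longrightarrow> e \<in> V \<Longrightarrow> tight i e - prob i = (1 - prob i) * L e"
proof -
  have sq: "expect (\<lambda>e. (tight i e - prob i - (1 - prob i) * L e)\<^sup>2) = (1 - prob i) * residual i L"
    by (rule expect_residual_sq[OF L])
  \<comment> \<open>An almost surely tight index makes \<open>L\<close> and \<open>tight i * L\<close> agree, so both have mean \<open>0\<close>.\<close>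
  have certain: "residual i L = 1" if "prob i = 1"
  proof -
    have "expect (\<lambda>e. 1 - tight i e) = 0"
      using that by (simp add: expect_diff expect_const prob_def)
    then have "tight i e = 1" if "e \<in> V" for e
      using expect_eq_0D[of "\<lambda>e. 1 - tight i e" e] that by (simp add: tight_def)
    then have "expect (\<lambda>e. tight i e * L e) = expect L" by (intro expect_cong) simp
    then show ?thesis using that L by (simp add: residual_def)
  qed
  show "0 \<le> residual i L"
  proof (cases "prob i = 1")
    case False
    then have "0 < 1 - prob i" using prob_le_1[of i] by simp
    moreover have "0 \<le> (1 - prob i) * residual i L" unfolding sq[symmetric] by (rule expect_nonneg) simp
    ultimately show ?thesis by (simp add: zero_le_mult_iff)
  qed (simp add: certain)
  show "tight i e - prob i = (1 - prob i) * L e" if "residual i L = 0" "e \<in> V"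
    using expect_eq_0D[OF sq[unfolded that(1) mult_zero_right] _ that(2)] by simp
qed

definition second_moment :: "'a \<Rightarrow> 'a" where
  "second_moment p = (\<Sum>e\<in>V. (w e * (X e \<bullet> p)) *\<^sub>R X e)"

lemma inner_second_moment: "second_moment p \<bullet> q = expect (\<lambda>e. (X e \<bullet> p) * (X e \<bullet> q))"
  by (simp add: second_moment_def expect_def inner_sum_left mult.assoc)

lemma linear_second_moment: "linear second_moment"
  by (rule linearI) (simp_all add: second_moment_def inner_simps distrib_left scaleR_add_left
      sum.distrib scaleR_sum_right mult.left_commute)

lemma principal_axes:
  obtains B where "finite B" "card B = DIM('a)" "pairwise orthogonal B" "\<And>b. b \<in> B \<Longrightarrow> norm b = 1"
    "span B = UNIV" "\<And>b c. b \<in> B \<Longrightarrow> c \<in> B \<Longrightarrow> b \<noteq> c \<Longrightarrow> expect (\<lambda>e. (X e \<bullet> b) * (X e \<bullet> c)) = 0"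
proof -
  have "second_moment x \<bullet> y = x \<bullet> second_moment y" for x y
    by (simp add: inner_second_moment inner_commute[of x] mult.commute)
  from diagonalizing_orthonormal_basis[OF linear_second_moment this subspace_UNIV]
  obtain B where B: "finite B" "pairwise orthogonal B" "\<forall>b\<in>B. norm b = 1" "span B = UNIV"
    "\<forall>b\<in>B. \<forall>c\<in>B. b \<noteq> c \<longrightarrow> second_moment b \<bullet> c = 0" by blast
  have "independent B" by (rule pairwise_orthogonal_independent[OF B(2)]) (use B(3) in force)
  then have "card B = DIM('a)" using B(4) by (metis dim_eq_card_independent dim_span dim_UNIV)
  then show ?thesis using that[of B] B by (simp add: inner_second_moment)
qed

context
  fixes B :: "'a set"
  assumes B: "finite B" "card B = DIM('a)" "pairwise orthogonal B" "\<And>b. b \<in> B \<Longrightarrow> norm b = 1"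
    "span B = UNIV" "\<And>b c. b \<in> B \<Longrightarrow> c \<in> B \<Longrightarrow> b \<noteq> c \<Longrightarrow> expect (\<lambda>e. (X e \<bullet> b) * (X e \<bullet> c)) = 0"
begin

definition moment :: "'a \<Rightarrow> real" where
  "moment b = expect (\<lambda>e. (X e \<bullet> b)\<^sup>2)"

text \<open>The diagonal entry at \<open>b\<close> of the matrix \<open>\<Sum>i\<in>I. (1 - prob i) *\<^sub>R (u i) (u i)\<^sup>T\<close>.\<close>

definition slack_weight :: "'a \<Rightarrow> real" where
  "slack_weight b = (\<Sum>i\<in>I. (1 - prob i) * (u i \<bullet> b)\<^sup>2)"

text \<open>The linear functional \<open>x \<mapsto> u i \<bullet> \<Theta> x\<close> evaluated at the random point, where \<open>\<Theta>\<close> is diagonal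
with entries \<open>\<theta>\<close> in the principal axes.\<close>

definition test :: "('a \<Rightarrow> real) \<Rightarrow> 'i \<Rightarrow> 'v \<Rightarrow> real" where
  "test \<theta> i e = (\<Sum>b\<in>B. \<theta> b * (u i \<bullet> b) * (X e \<bullet> b))"

lemma parseval: "(\<Sum>b\<in>B. (x \<bullet> b) * (y \<bullet> b)) = x \<bullet> y"
  using B by (intro inner_orthonormal_basis) auto

lemma expect_test: "expect (test \<theta> i) = 0"
  unfolding test_def expect_sum expect_cmult expect_inner by simp

lemma expect_test_sq: "expect (\<lambda>e. (test \<theta> i e)\<^sup>2) = (\<Sum>b\<in>B. (\<theta> b)\<^sup>2 * (u i \<bullet> b)\<^sup>2 * moment b)"
proof -
  have "(test \<theta> i e)\<^sup>2 = (\<Sum>b\<in>B. \<Sum>c\<in>B. (\<theta> b * (u i \<bullet> b) * (\<theta> c * (u i \<bullet> c))) * ((X e \<bullet> b) * (X e \<bullet> c)))" for e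
    unfolding test_def power2_eq_square sum_product by (intro sum.cong refl) (simp add: mult_ac)
  then have "expect (\<lambda>e. (test \<theta> i e)\<^sup>2) = (\<Sum>b\<in>B. \<Sum>c\<in>B. (\<theta> b * (u i \<bullet> b) * (\<theta> c * (u i \<bullet> c))) *
      expect (\<lambda>e. (X e \<bullet> b) * (X e \<bullet> c)))"
    by (simp only: expect_sum expect_cmult)
  also have "\<dots> = (\<Sum>b\<in>B. \<Sum>c\<in>B. if c = b then (\<theta> b)\<^sup>2 * (u i \<bullet> b)\<^sup>2 * moment b else 0)"
    using B(6) by (intro sum.cong refl) (auto simp: moment_def power2_eq_square)
  finally show ?thesis using B(1) by simp
qed

lemma sum_expect_tight_test: "(\<Sum>i\<in>I. expect (\<lambda>e. tight i e * test \<theta> i e)) = (\<Sum>b\<in>B. \<theta> b)"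
proof -
  have "(\<Sum>i\<in>I. expect (\<lambda>e. tight i e * test \<theta> i e)) = expect (\<lambda>e. \<Sum>i\<in>I. tight i e * test \<theta> i e)"
    by (simp add: expect_sum)
  also have "\<dots> = expect (\<lambda>e. \<Sum>b\<in>B. \<theta> b * (\<Sum>i\<in>S e. (u i \<bullet> b) * (X e \<bullet> b)))"
  proof (rule expect_cong)
    fix e assume "e \<in> V"
    then have "(\<Sum>i\<in>I. tight i e * test \<theta> i e) = (\<Sum>i\<in>S e. \<Sum>b\<in>B. \<theta> b * (u i \<bullet> b) * (X e \<bullet> b))"
      by (simp add: sum_tight test_def)
    also have "\<dots> = (\<Sum>b\<in>B. \<theta> b * (\<Sum>i\<in>S e. (u i \<bullet> b) * (X e \<bullet> b)))"
      by (subst sum.swap) (simp add: sum_distrib_left mult.assoc)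
    finally show "(\<Sum>i\<in>I. tight i e * test \<theta> i e) = \<dots>" .
  qed
  also have "\<dots> = (\<Sum>b\<in>B. \<theta> b * (b \<bullet> b))"
    using dual by (simp only: expect_sum expect_cmult) (simp add: expect_def)
  also have "\<dots> = (\<Sum>b\<in>B. \<theta> b)"
    using B(4) by (intro sum.cong refl) (simp add: norm_eq_1)
  finally show ?thesis .
qed

text \<open>Orthogonality of the principal axes removes the mixed terms of the quadratic part, the identity
\<open>dual\<close> evaluates the linear part, and the constant part counts the tight indices.\<close>

lemma sum_residuals:
  fixes \<theta> :: "'a \<Rightarrow> real"
  shows "(\<Sum>i\<in>I. residual i (test \<theta> i)) =
   real DIM('a) - 2 * (\<Sum>b\<in>B. \<theta> b) + (\<Sum>b\<in>B. (\<theta> b)\<^sup>2 * (moment b * slack_weight b))"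
proof -
  have "(\<Sum>i\<in>I. (1 - prob i) * expect (\<lambda>e. (test \<theta> i e)\<^sup>2)) =
      (\<Sum>b\<in>B. \<Sum>i\<in>I. (\<theta> b)\<^sup>2 * moment b * ((1 - prob i) * (u i \<bullet> b)\<^sup>2))"
    unfolding expect_test_sq sum_distrib_left by (subst sum.swap) (simp add: mult_ac)
  also have "\<dots> = (\<Sum>b\<in>B. (\<theta> b)\<^sup>2 * (moment b * slack_weight b))"
    by (simp add: slack_weight_def sum_distrib_left mult.assoc)
  finally show ?thesis
    by (simp add: residual_def sum.distrib sum_subtractf sum_prob sum_distrib_left[symmetric] sum_expect_tight_test)
qed

text \<open>If \<open>X\<close> had no component along \<open>b\<close>, the identity \<open>dual\<close> for \<open>p = q = b\<close> would read \<open>0 = 1\<close>.\<close>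

lemma moment_pos: "b \<in> B \<Longrightarrow> 0 < moment b"
proof (rule ccontr)
  assume b: "b \<in> B" and "\<not> 0 < moment b"
  moreover have "0 \<le> moment b" unfolding moment_def by (rule expect_nonneg) simp
  ultimately have "moment b = 0" by simp
  then have "X e \<bullet> b = 0" if "e \<in> V" for e
    using expect_eq_0D[of "\<lambda>e. (X e \<bullet> b)\<^sup>2" e] that by (simp add: moment_def)
  then have "(\<Sum>e\<in>V. w e * (\<Sum>i\<in>S e. (u i \<bullet> b) * (X e \<bullet> b))) = 0"
    by (intro sum.neutral) simp
  then have "b \<bullet> b = 0" by (simp only: dual)
  then show False using B(4)[OF b] by simp
qed

lemma slack_weight_nonneg: "0 \<le> slack_weight b"
  using prob_le_1 by (simp add: slack_weight_def sum_nonneg)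

lemma sum_moment: "(\<Sum>b\<in>B. moment b) = expect (\<lambda>e. (norm (X e))\<^sup>2)"
proof -
  have "(\<Sum>b\<in>B. moment b) = expect (\<lambda>e. \<Sum>b\<in>B. (X e \<bullet> b)\<^sup>2)"
    by (simp only: moment_def expect_sum)
  then show ?thesis by (simp add: power2_eq_square parseval flip: power2_norm_eq_inner)
qed

lemma sum_slack_weight: "(\<Sum>b\<in>B. slack_weight b) = real DIM('a)"
proof -
  have "(\<Sum>b\<in>B. slack_weight b) = (\<Sum>i\<in>I. (1 - prob i) * (\<Sum>b\<in>B. (u i \<bullet> b)\<^sup>2))"
    unfolding slack_weight_def by (subst sum.swap) (simp add: sum_distrib_left)
  also have "\<dots> = (\<Sum>i\<in>I. 1 - prob i)"
    by (intro sum.cong refl) (simp add: power2_eq_square parseval unit norm_eq_1[symmetric])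
  finally show ?thesis by (simp add: sum_subtractf sum_prob card_I)
qed

definition mean_weight :: "'a \<Rightarrow> real" where
  "mean_weight b = (moment b + slack_weight b) / 2"

definition penalty :: "'a \<Rightarrow> real" where
  "penalty b = ((moment b - slack_weight b) / (2 * mean_weight b))\<^sup>2 +
            2 * ((mean_weight b - 1)\<^sup>2 / mean_weight b)"

text \<open>The identity \<open>sum_residuals\<close> for \<open>\<theta> = 1 / a\<close> with \<open>a = mean_weight\<close>. It uses
\<open>moment b * slack_weight b / a\<^sup>2 = 1 - ((moment b - slack_weight b) / (2 * a))\<^sup>2\<close> and
\<open>a + 1 / a - 2 = (a - 1)\<^sup>2 / a\<close>, and the fact that the mean weights add up to the average of
\<open>expect (\<lambda>e. (norm (X e))\<^sup>2)\<close> and the dimension.\<close>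

lemma excess_eq_sum_of_squares:
  "(\<Sum>i\<in>I. residual i (test (\<lambda>b. 1 / mean_weight b) i)) +
     (\<Sum>b\<in>B. penalty b) =
   expect (\<lambda>e. (norm (X e))\<^sup>2) - real DIM('a)" (is "?R + ?Q = _")
proof -
  let ?a = mean_weight
  have "(1 / ?a b)\<^sup>2 * (moment b * slack_weight b) + ((moment b - slack_weight b) / (2 * ?a b))\<^sup>2
      + 2 * ((?a b - 1)\<^sup>2 / ?a b) = moment b + slack_weight b + 2 * (1 / ?a b) - 3" if b: "b \<in> B" for b
  proof -
    have pos: "0 < ?a b" using moment_pos[OF b] slack_weight_nonneg[of b] by (simp add: mean_weight_def)
    have two: "moment b + slack_weight b = 2 * ?a b" by (simp add: mean_weight_def)
    have "(1 / ?a b)\<^sup>2 * (moment b * slack_weight b) + ((moment b - slack_weight b) / (2 * ?a b))\<^sup>2 =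
        ((moment b + slack_weight b) / (2 * ?a b))\<^sup>2"
      using pos by (simp add: field_simps power2_eq_square)
    also have "\<dots> = 1" unfolding two using pos by simp
    finally have "(1 / ?a b)\<^sup>2 * (moment b * slack_weight b) + ((moment b - slack_weight b) / (2 * ?a b))\<^sup>2 = 1" .
    moreover have "(?a b - 1)\<^sup>2 / ?a b = ?a b - 2 + 1 / ?a b"
      using pos by (simp add: field_simps power2_eq_square)
    ultimately show ?thesis using two by linarith
  qed
  then have "(1 / ?a b)\<^sup>2 * (moment b * slack_weight b) + penalty b =
      moment b + slack_weight b + 2 * (1 / ?a b) - 3" if "b \<in> B" for b
    using that by (simp add: penalty_def add.assoc)
  then have "(\<Sum>b\<in>B. (1 / ?a b)\<^sup>2 * (moment b * slack_weight b) + penalty b) =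
      (\<Sum>b\<in>B. moment b + slack_weight b + 2 * (1 / ?a b) - 3)"
    by (rule sum.cong[OF refl])
  then have "(\<Sum>b\<in>B. (1 / ?a b)\<^sup>2 * (moment b * slack_weight b)) + sum penalty B =
      sum moment B + sum slack_weight B + 2 * (\<Sum>b\<in>B. 1 / ?a b) - 3 * real DIM('a)"
    by (simp only: sum.distrib sum_subtractf sum_distrib_left[symmetric] sum_constant B(2))
  then show ?thesis
    unfolding sum_residuals sum_moment sum_slack_weight by linarith
qed

lemma mean_weight_pos: "b \<in> B \<Longrightarrow> 0 < mean_weight b"
  using moment_pos[of b] slack_weight_nonneg[of b] by (simp add: mean_weight_def)

lemma sum_residuals_nonneg: "0 \<le> (\<Sum>i\<in>I. residual i (test \<theta> i))"
  by (intro sum_nonneg residual_nonneg(1) expect_test)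

lemma penalty_nonneg: "b \<in> B \<Longrightarrow> 0 \<le> penalty b"
  using mean_weight_pos[of b] by (simp add: penalty_def)

lemma expect_norm_sq_ge_in_axes: "real DIM('a) \<le> expect (\<lambda>e. (norm (X e))\<^sup>2)"
  using excess_eq_sum_of_squares sum_residuals_nonneg[of "\<lambda>b. 1 / mean_weight b"]
    sum_nonneg[of B penalty, OF penalty_nonneg] by simp

text \<open>The vanishing penalties make the second moment matrix the identity, so the vanishing residuals say
\<open>tight i - prob i = (1 - prob i) * (u i \<bullet> X)\<close>. Multiplying by \<open>u i \<bullet> X\<close> and taking expectations
evaluates the mixed term of the residual, and then the vanishing of the residual reads \<open>2 * prob i = 1\<close>.\<close>

lemma equality_in_axes:
  assumes eq: "expect (\<lambda>e. (norm (X e))\<^sup>2) = real DIM('a)" and i: "i \<in> I" and e: "e \<in> V"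
  shows "u i \<bullet> X e = (if i \<in> S e then 1 else - 1)"
proof -
  have "(\<Sum>b\<in>B. penalty b) = 0"
    and R: "(\<Sum>i\<in>I. residual i (test (\<lambda>b. 1 / mean_weight b) i)) = 0"
    using excess_eq_sum_of_squares sum_residuals_nonneg[of "\<lambda>b. 1 / mean_weight b"]
      sum_nonneg[of B penalty, OF penalty_nonneg] eq by simp_all
  then have zero: "penalty b = 0" if "b \<in> B" for b
    using that sum_nonneg_eq_0_iff[of B penalty] B(1) penalty_nonneg by simp
  have a: "mean_weight b = 1" and m: "moment b = 1" if b: "b \<in> B" for b
  proof -
    \<comment> \<open>Both summands of the penalty vanish: the first says \<open>moment b = slack_weight b\<close>, the second that their mean is \<open>1\<close>.\<close>
    note pos = mean_weight_pos[OF b]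
    have "0 \<le> (mean_weight b - 1)\<^sup>2 / mean_weight b" using pos by simp
    then have "((moment b - slack_weight b) / (2 * mean_weight b))\<^sup>2 = 0"
       "(mean_weight b - 1)\<^sup>2 / mean_weight b = 0"
      using zero[OF b, unfolded penalty_def] zero_le_power2[of "(moment b - slack_weight b) / (2 * mean_weight b)"] by linarith+
    then show "mean_weight b = 1" "moment b = 1" using pos by (auto simp: mean_weight_def)
  qed
  have test: "test (\<lambda>b. 1 / mean_weight b) j = (\<lambda>e. u j \<bullet> X e)" for j
  proof
    fix e
    have "test (\<lambda>b. 1 / mean_weight b) j e = (\<Sum>b\<in>B. (u j \<bullet> b) * (X e \<bullet> b))"
      unfolding test_def by (rule sum.cong) (simp_all add: a)
    then show "test (\<lambda>b. 1 / mean_weight b) j e = u j \<bullet> X e" by (simp add: parseval)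
  qed
  have centred: "expect (\<lambda>e. u i \<bullet> X e) = 0"
    using expect_test[of "\<lambda>b. 1 / mean_weight b" i] by (simp add: test)
  have "\<forall>i\<in>I. residual i (test (\<lambda>b. 1 / mean_weight b) i) = 0"
    by (rule sum_nonneg_eq_0_iff[THEN iffD1, OF finite_I _ R]) (rule residual_nonneg(1)[OF expect_test])
  then have res0: "residual i (\<lambda>e. u i \<bullet> X e) = 0" unfolding test using i by blast
  note res = residual_nonneg(2)[OF centred res0]
  have "expect (\<lambda>e. (u i \<bullet> X e)\<^sup>2) = (\<Sum>b\<in>B. (u i \<bullet> b)\<^sup>2)"
    using expect_test_sq[of "\<lambda>b. 1 / mean_weight b" i] by (simp add: test a m)
  also have "\<dots> = 1" using unit[OF i] by (simp add: power2_eq_square parseval norm_eq_1)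
  finally have second: "expect (\<lambda>e. (u i \<bullet> X e)\<^sup>2) = 1" .
  \<comment> \<open>On the support, \<open>tight i\<close> is affine in \<open>u i \<bullet> X\<close>, so the first two moments determine this expectation.\<close>
  have first: "expect (\<lambda>e. tight i e * (u i \<bullet> X e)) = 1 - prob i"
  proof -
    have "expect (\<lambda>e. tight i e * (u i \<bullet> X e)) =
        expect (\<lambda>e. prob i * (u i \<bullet> X e) + (1 - prob i) * (u i \<bullet> X e)\<^sup>2)"
    proof (rule expect_cong)
      fix e assume "e \<in> V"
      then have T: "tight i e = prob i + (1 - prob i) * (u i \<bullet> X e)" using res[of e] by linarith
      show "tight i e * (u i \<bullet> X e) = prob i * (u i \<bullet> X e) + (1 - prob i) * (u i \<bullet> X e)\<^sup>2"
        unfolding T by (simp add: power2_eq_square algebra_simps)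
    qed
    then show ?thesis by (simp add: expect_add expect_cmult centred second)
  qed
  have p: "prob i = 1 / 2" using res0 by (simp add: residual_def first second)
  have "tight i e - 1 / 2 = (1 - 1 / 2) * (u i \<bullet> X e)" using res[OF e] unfolding p .
  then show ?thesis by (cases "i \<in> S e") (simp_all add: tight_def)
qed

end

theorem expect_norm_sq_ge: "real DIM('a) \<le> expect (\<lambda>e. (norm (X e))\<^sup>2)"
  by (rule principal_axes, rule expect_norm_sq_ge_in_axes)

theorem sign_if_expect_norm_sq_eq:
  assumes "expect (\<lambda>e. (norm (X e))\<^sup>2) = real DIM('a)" "i \<in> I" "e \<in> V"
  shows "u i \<bullet> X e = (if i \<in> S e then 1 else - 1)"
  by (rule principal_axes, rule equality_in_axes[OF _ _ _ _ _ _ assms])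

end

section \<open>The bound and its equality case\<close>

lemma polytope_balanced_measure:
  fixes u :: "nat \<Rightarrow> real^'n"
  assumes fin: "finite I" and card: "card I = 2 * CARD('n)" and unit: "\<And>i. i \<in> I \<Longrightarrow> norm (u i) = 1"
    and bdd: "bounded (polyhedron_of u (\<lambda>_. 1) I)"
  obtains V w where "balanced_measure I u V w range (vertex u (\<lambda>_. 1))"
    "\<And>e. e \<in> V \<Longrightarrow> det (row_matrix u e) \<noteq> 0"
    "\<And>e. e \<in> V \<Longrightarrow> vertex u (\<lambda>_. 1) e \<in> polyhedron_of u (\<lambda>_. 1) I"
proof -
  obtain V w where V: "finite V"
    "\<And>e. e \<in> V \<Longrightarrow> range e \<subseteq> I" "\<And>e. e \<in> V \<Longrightarrow> det (row_matrix u e) \<noteq> 0"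
    "\<And>e. e \<in> V \<Longrightarrow> vertex u (\<lambda>_. 1) e \<in> polyhedron_of u (\<lambda>_. 1) I" "\<And>e. e \<in> V \<Longrightarrow> 0 < w e"
    "sum w V = 1"
    "\<And>q. (\<Sum>e\<in>V. w e * (vertex u (\<lambda>_. 1) e \<bullet> q)) = 0"
    "\<And>p q. (\<Sum>e\<in>V. w e * (\<Sum>a\<in>UNIV. (u (e a) \<bullet> p) * (vertex u (\<lambda>_. 1) e \<bullet> q))) = p \<bullet> q"
    using exists_vertex_measure[OF fin bdd] by blast
  have inj: "inj e" if "e \<in> V" for e using V(3)[OF that] by (rule inj_if_det_row_matrix_nonzero)
  have "balanced_measure I u V w range (vertex u (\<lambda>_. 1))"
  proof
    show "card (range e) = DIM(real^'n)" if "e \<in> V" for e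
      using card_image[OF inj[OF that]] by simp
    show "(\<Sum>e\<in>V. w e * (\<Sum>i\<in>range e. (u i \<bullet> p) * (vertex u (\<lambda>_. 1) e \<bullet> q))) = p \<bullet> q" for p q
      unfolding V(8)[symmetric, of p q] by (rule sum.cong) (simp_all add: sum.reindex[OF inj])
  qed (use fin card unit V in simp_all)
  then show ?thesis using that V by blast
qed

lemma sqrt_dim_le_norm:
  fixes u :: "nat \<Rightarrow> real^'n"
  assumes fin: "finite I" and card: "card I = 2 * CARD('n)" and unit: "\<And>i. i \<in> I \<Longrightarrow> norm (u i) = 1"
  shows "\<exists>x\<in>polyhedron_of u (\<lambda>_. 1) I. sqrt CARD('n) \<le> norm x"
proof (cases "bounded (polyhedron_of u (\<lambda>_. 1) I)")
  case False
  then show ?thesis unfolding bounded_iff by (meson linear)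
next
  case True
  obtain V w where m: "balanced_measure I u V w range (vertex u (\<lambda>_. 1))"
    and P: "\<And>e. e \<in> V \<Longrightarrow> vertex u (\<lambda>_. 1) e \<in> polyhedron_of u (\<lambda>_. 1) I"
    using polytope_balanced_measure[of I u, OF fin card unit True] by blast
  interpret balanced_measure I u V w range "vertex u (\<lambda>_. 1)" by (rule m)
  show ?thesis
  proof (rule ccontr)
    assume far: "\<not> ?thesis"
    have lt: "(norm (vertex u (\<lambda>_. 1) e))\<^sup>2 < CARD('n)" if "e \<in> V" for e
    proof -
      have "norm (vertex u (\<lambda>_. 1) e) < sqrt CARD('n)"
        using far P[OF that] by (simp add: not_le)
      from power_strict_mono[OF this, of 2] show ?thesis by simp
    qed
    have "V \<noteq> {}"
    proof
      assume "V = {}"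
      then show False using w_sum by simp
    qed
    then have "expect (\<lambda>e. (norm (vertex u (\<lambda>_. 1) e))\<^sup>2) < (\<Sum>e\<in>V. w e * CARD('n))"
      unfolding expect_def using lt w_pos finite_V by (intro sum_strict_mono) auto
    also have "\<dots> = CARD('n)" by (simp add: sum_distrib_right[symmetric] w_sum)
    finally show False using expect_norm_sq_ge by simp
  qed
qed

text \<open>The squared norm averages to at least the dimension and never exceeds it, so it is constant on the
support, and every vertex in the support is as required.\<close>

lemma sign_vertex_if_extremal:
  fixes u :: "nat \<Rightarrow> real^'n"
  assumes fin: "finite I" and card: "card I = 2 * CARD('n)" and unit: "\<And>i. i \<in> I \<Longrightarrow> norm (u i) = 1"
    and max: "\<And>y. y \<in> polyhedron_of u (\<lambda>_. 1) I \<Longrightarrow> norm y \<le> sqrt CARD('n)"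
  obtains e where "range e \<subseteq> I" "det (row_matrix u e) \<noteq> 0"
    "(norm (vertex u (\<lambda>_. 1) e))\<^sup>2 = CARD('n)"
    "\<And>i. i \<in> I \<Longrightarrow> u i \<bullet> vertex u (\<lambda>_. 1) e = (if i \<in> range e then 1 else - 1)"
proof -
  have "bounded (polyhedron_of u (\<lambda>_. 1) I)" unfolding bounded_iff using max by blast
  then obtain V w where m: "balanced_measure I u V w range (vertex u (\<lambda>_. 1))"
    and d: "\<And>e. e \<in> V \<Longrightarrow> det (row_matrix u e) \<noteq> 0"
    and P: "\<And>e. e \<in> V \<Longrightarrow> vertex u (\<lambda>_. 1) e \<in> polyhedron_of u (\<lambda>_. 1) I"
    using polytope_balanced_measure[of I u, OF fin card unit] by blast
  interpret balanced_measure I u V w range "vertex u (\<lambda>_. 1)" by (rule m)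
  let ?g = "\<lambda>e. (norm (vertex u (\<lambda>_. 1) e))\<^sup>2"
  have le: "?g e \<le> CARD('n)" if "e \<in> V" for e
    using power_mono[OF max[OF P[OF that]], of 2] by simp
  then have "expect ?g \<le> expect (\<lambda>_. CARD('n))" by (rule expect_mono)
  then have eq: "expect ?g = CARD('n)" using expect_norm_sq_ge by (simp add: expect_const)
  obtain e where e: "e \<in> V" using w_sum by fastforce
  have "expect (\<lambda>e. CARD('n) - ?g e) = 0" by (simp add: expect_diff expect_const eq)
  from expect_eq_0D[OF this _ e] have "?g e = CARD('n)" using le by simp
  then show ?thesis
    using that[of e] S_subset[OF e] d[OF e] sign_if_expect_norm_sq_eq[OF _ _ e] eq by simp
qed

text \<open>Let \<open>f\<close> be a dual vector at the extremal vertex \<open>x\<close>. All constraints outside the basis have slack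
\<open>2\<close> at \<open>x\<close>, so \<open>x - t *\<^sub>R f\<close> stays feasible up to \<open>t = 2 / norm f\<close>, and since it is not longer than \<open>x\<close> this gives \<open>norm f \<le> x \<bullet> f\<close>.
On the other hand \<open>norm f \<ge> 1\<close>, and the numbers \<open>x \<bullet> f\<close> add up to \<open>(norm x)\<^sup>2\<close>, which is the dimension. Hence
every dual vector has norm \<open>1\<close> and coincides with its normal. If \<open>- f\<close> were not a normal, the
edge would be longer than \<open>2\<close>, and its other end would be too far from the origin.\<close>

lemma facets_if_extremal:
  fixes u :: "'i \<Rightarrow> real^'n"
  assumes fin: "finite I" and unit: "\<And>i. i \<in> I \<Longrightarrow> norm (u i) = 1"
    and max: "\<And>y. y \<in> polyhedron_of u (\<lambda>_. 1) I \<Longrightarrow> norm y \<le> sqrt CARD('n)"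
    and eI: "range e \<subseteq> I" and d: "det (row_matrix u e) \<noteq> 0"
    and norm_x: "(norm (vertex u (\<lambda>_. 1) e))\<^sup>2 = CARD('n)"
    and signs: "\<And>i. i \<in> I \<Longrightarrow> u i \<bullet> vertex u (\<lambda>_. 1) e = (if i \<in> range e then 1 else - 1)"
  shows "dual_vector u e a = u (e a)" and "\<exists>j\<in>I. u j = - u (e a)"
proof -
  define x where "x = vertex u (\<lambda>_. 1) e"
  let ?f = "dual_vector u e"
  have step: "t * (?f a \<bullet> ?f a) \<le> 2 * (x \<bullet> ?f a)"
    if t: "0 < t" and out: "\<And>j. j \<in> I - range e \<Longrightarrow> t * - (u j \<bullet> ?f a) \<le> 2" for t a
  proof -
    have "x - t *\<^sub>R ?f a \<in> polyhedron_of u (\<lambda>_. 1) I"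
      unfolding polyhedron_of_def
    proof safe
      fix i assume i: "i \<in> I"
      show "u i \<bullet> (x - t *\<^sub>R ?f a) \<le> 1"
      proof (cases "i \<in> range e")
        case True
        then obtain c where "i = e c" by auto
        then show ?thesis using t signs[OF i] by (simp add: inner_diff_right inner_dual_vector[OF d] x_def)
      next
        case False
        then show ?thesis using out[of i] signs[OF i] i by (simp add: inner_diff_right x_def)
      qed
    qed
    from power_mono[OF max[OF this], of 2] have "(norm (x - t *\<^sub>R ?f a))\<^sup>2 \<le> (norm x)\<^sup>2"
      by (simp add: x_def norm_x)
    then have "t * (t * (?f a \<bullet> ?f a)) \<le> t * (2 * (x \<bullet> ?f a))"
      by (simp add: power2_norm_eq_inner inner_simps inner_commute algebra_simps)
    then show ?thesis using t by (simp add: mult_le_cancel_left_pos)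
  qed
  have ge1: "1 \<le> norm (?f a)" for a
  proof -
    have "norm (u (e a)) = 1" using unit eI by blast
    then show ?thesis
      using Cauchy_Schwarz_ineq2[of "u (e a)" "?f a"] inner_dual_vector[OF d, of a a] by simp
  qed
  have le: "norm (?f a) \<le> x \<bullet> ?f a" for a
  proof -
    have n: "0 < norm (?f a)" using ge1[of a] by linarith
    have "2 / norm (?f a) * (?f a \<bullet> ?f a) \<le> 2 * (x \<bullet> ?f a)"
    proof (rule step)
      fix j assume j: "j \<in> I - range e"
      have "- (u j \<bullet> ?f a) \<le> norm (?f a)"
        using Cauchy_Schwarz_ineq2[of "u j" "?f a"] unit[of j] j by auto
      then show "2 / norm (?f a) * - (u j \<bullet> ?f a) \<le> 2" using n by (simp add: divide_le_eq field_simps)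
    qed (use n in simp)
    then show ?thesis using n by (simp add: power2_norm_eq_inner[symmetric] power2_eq_square)
  qed
  have x: "x = (\<Sum>a\<in>UNIV. ?f a)" by (simp add: x_def vertex_def)
  have "(\<Sum>a\<in>UNIV. x \<bullet> ?f a - 1) = 0"
    using norm_x by (simp add: sum_subtractf inner_sum_right[symmetric] x[symmetric] x_def[symmetric] power2_norm_eq_inner)
  moreover have "0 \<le> x \<bullet> ?f a - 1" for a using ge1[of a] le[of a] by simp
  ultimately have xf: "x \<bullet> ?f a = 1" for a by (simp add: sum_nonneg_eq_0_iff)
  have nf: "norm (?f a) = 1" for a using ge1[of a] le[of a] xf[of a] by simp
  have uu: "u (e a) \<bullet> u (e a) = 1" for a using unit[of "e a"] eI by (auto simp: norm_eq_1)
  show fu: "?f a = u (e a)" for a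
  proof -
    have "(?f a - u (e a)) \<bullet> (?f a - u (e a)) = 0"
      using nf[of a] uu[of a] inner_dual_vector[OF d, of a a]
      by (simp add: inner_simps inner_commute norm_eq_1)
    then show ?thesis by simp
  qed
  show "\<exists>j\<in>I. u j = - u (e a)"
  proof (rule ccontr)
    assume none: "\<not> ?thesis"
    \<comment> \<open>Equality in the Cauchy-Schwarz inequality would make \<open>u j\<close> opposite to \<open>u (e a)\<close>.\<close>
    have lt: "- (u j \<bullet> ?f a) < 1" if "j \<in> I" for j
    proof (rule ccontr)
      assume "\<not> ?thesis"
      moreover have "u j \<bullet> u j = 1" using unit[OF that] by (simp add: norm_eq_1)
      ultimately have "(u j + u (e a)) \<bullet> (u j + u (e a)) \<le> 0"
        using uu[of a] by (simp add: inner_simps inner_commute fu)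
      then have "u j + u (e a) = 0" by (metis inner_ge_zero inner_eq_zero_iff order_antisym)
      then show False using none that by (metis add_eq_0_iff2)
    qed
    \<comment> \<open>Some \<open>t > 2\<close> is still admissible in \<open>step\<close>, although \<open>t \<le> 2\<close> follows from it.\<close>
    have "\<forall>\<^sub>F t in at_right 2. \<forall>j\<in>I. t * - (u j \<bullet> ?f a) < 2"
    proof (intro eventually_ball_finite fin ballI)
      fix j assume "j \<in> I"
      then have "2 * - (u j \<bullet> ?f a) < 2" using lt[of j] by linarith
      moreover have lim: "((\<lambda>t. t * - (u j \<bullet> ?f a)) \<longlongrightarrow> 2 * - (u j \<bullet> ?f a)) (at_right 2)"
        by (intro tendsto_intros)
      ultimately show "\<forall>\<^sub>F t in at_right 2. t * - (u j \<bullet> ?f a) < 2" using order_tendstoD(2)[OF lim] by blast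
    qed
    moreover have "\<forall>\<^sub>F t in at_right (2::real). 2 < t" by (simp add: eventually_at_right_less)
    ultimately have "\<forall>\<^sub>F t in at_right 2. (\<forall>j\<in>I. t * - (u j \<bullet> ?f a) < 2) \<and> 2 < t"
      by eventually_elim simp
    then obtain t where t: "\<And>j. j \<in> I \<Longrightarrow> t * - (u j \<bullet> ?f a) < 2" "2 < t"
      using eventually_happens'[OF trivial_limit_at_right_real] by blast
    have "t * (?f a \<bullet> ?f a) \<le> 2 * (x \<bullet> ?f a)"
      by (rule step) (use t in \<open>simp_all add: less_imp_le\<close>)
    then show False using t xf[of a] nf[of a] by (simp add: norm_eq_1)
  qed
qed

lemma index_set_covered:
  fixes e g :: "'n::finite \<Rightarrow> 'i"
  assumes "finite I" "card I = 2 * CARD('n)" "range e \<subseteq> I" "range g \<subseteq> I"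
    "inj e" "inj g" "range e \<inter> range g = {}"
  shows "I = range e \<union> range g"
proof (rule sym, rule card_subset_eq)
  show "card (range e \<union> range g) = card I"
    using assms(2) card_Un_disjoint[OF _ _ assms(7)] card_image[OF assms(5)] card_image[OF assms(6)]
    by simp
qed (use assms in auto)

text \<open>If some point \<open>y\<close> had a coordinate \<open>r\<close> with \<open>\<bar>r\<bar> > 1\<close> along \<open>u (e a)\<close>, the vertex of the cube with all coordinates
\<open>1\<close> could be moved to have the coordinate \<open>r\<close> there. The result still satisfies all constraints, those
along \<open>u (e a)\<close> because \<open>y\<close> does, but it is longer than \<open>sqrt CARD('n)\<close>.\<close>

lemma polyhedron_eq_cube:
  fixes u :: "'i \<Rightarrow> real^'n" and e :: "'n \<Rightarrow> 'i"
  assumes on: "\<And>a c. u (e a) \<bullet> u (e c) = (if a = c then 1 else 0)"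
    and axes: "\<And>i. i \<in> I \<Longrightarrow> \<exists>a. u i = u (e a) \<or> u i = - u (e a)"
    and b: "\<And>i. i \<in> I \<Longrightarrow> 1 \<le> b i"
    and max: "\<And>y. y \<in> polyhedron_of u b I \<Longrightarrow> norm y \<le> sqrt CARD('n)"
  shows "polyhedron_of u b I = {y. \<forall>a. \<bar>u (e a) \<bullet> y\<bar> \<le> 1}"
proof
  show "{y. \<forall>a. \<bar>u (e a) \<bullet> y\<bar> \<le> 1} \<subseteq> polyhedron_of u b I"
    unfolding polyhedron_of_def
  proof safe
    fix y i assume y: "\<forall>a. \<bar>u (e a) \<bullet> y\<bar> \<le> 1" and i: "i \<in> I"
    obtain a where "u i = u (e a) \<or> u i = - u (e a)" using axes[OF i] by blast
    then show "u i \<bullet> y \<le> b i" using y[rule_format, of a] b[OF i] by auto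
  qed
  show "polyhedron_of u b I \<subseteq> {y. \<forall>a. \<bar>u (e a) \<bullet> y\<bar> \<le> 1}"
  proof safe
    fix y a assume y: "y \<in> polyhedron_of u b I"
    define r where "r = u (e a) \<bullet> y"
    define x where "x = (\<Sum>c\<in>UNIV. u (e c))"
    define z where "z = x + (r - 1) *\<^sub>R u (e a)"
    have ux: "u (e c) \<bullet> x = 1" for c by (simp add: x_def inner_sum_right on)
    have xx: "x \<bullet> x = CARD('n)" by (subst (1) x_def) (simp add: inner_sum_left ux)
    have uz: "u (e c) \<bullet> z = (if c = a then r else 1)" for c
      by (simp add: z_def inner_add_right ux on)
    have "z \<in> polyhedron_of u b I"
      unfolding polyhedron_of_def
    proof safe
      fix i assume i: "i \<in> I"
      obtain c where c: "u i = u (e c) \<or> u i = - u (e c)" using axes[OF i] by blast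
      show "u i \<bullet> z \<le> b i"
      proof (cases "c = a")
        case True
        then have "u i \<bullet> z = u i \<bullet> y" using c by (auto simp: uz r_def)
        then show ?thesis using y i by (simp add: polyhedron_of_def)
      next
        case False
        then show ?thesis using c b[OF i] by (auto simp: uz)
      qed
    qed
    from power_mono[OF max[OF this], of 2] have "(norm z)\<^sup>2 \<le> CARD('n)" by simp
    moreover have "(norm z)\<^sup>2 = CARD('n) + (r\<^sup>2 - 1)"
    proof -
      have "z \<bullet> z = x \<bullet> x + 2 * (r - 1) * (u (e a) \<bullet> x) + (r - 1)\<^sup>2 * (u (e a) \<bullet> u (e a))"
        unfolding z_def by (simp add: inner_simps inner_commute power2_eq_square algebra_simps)
      also have "\<dots> = CARD('n) + (r\<^sup>2 - 1)" by (simp add: ux xx on power2_eq_square algebra_simps)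
      finally show ?thesis by (simp add: power2_norm_eq_inner)
    qed
    ultimately have "r\<^sup>2 \<le> 1" by simp
    then show "\<bar>u (e a) \<bullet> y\<bar> \<le> 1" by (simp add: r_def abs_square_le_1)
  qed
qed

lemma cube_eq_orthogonal_image:
  fixes v :: "'n \<Rightarrow> real^'n"
  assumes on: "\<And>a c. v a \<bullet> v c = (if a = c then 1 else 0)"
  shows "\<exists>U :: real^'n \<Rightarrow> real^'n. orthogonal_transformation U \<and>
           {y. \<forall>a. \<bar>v a \<bullet> y\<bar> \<le> 1} = U ` cbox (\<chi> i. - 1) (\<chi> i. 1)"
proof -
  define A where "A = (\<chi> a. v a)"
  have "A ** transpose A = mat 1"
    using on by (simp add: vec_eq_iff A_def matrix_matrix_mult_def transpose_def mat_def inner_vec_def)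
  then have orth: "orthogonal_matrix A"
    by (simp add: orthogonal_matrix_def matrix_left_right_inverse)
  then have A: "transpose A ** A = mat 1" "A ** transpose A = mat 1" by (auto simp: orthogonal_matrix_def)
  have comp: "(A *v y) $ a = v a \<bullet> y" for y a
    by (simp add: A_def matrix_vector_mult_def inner_vec_def)
  have "orthogonal_transformation ((*v) (transpose A))"
    using orth by (simp add: orthogonal_transformation_matrix orthogonal_matrix_transpose)
  moreover have "{y. \<forall>a. \<bar>v a \<bullet> y\<bar> \<le> 1} = (*v) (transpose A) ` cbox (\<chi> i. - 1) (\<chi> i. 1)"
  proof (intro set_eqI iffI)
    fix y assume "y \<in> {y. \<forall>a. \<bar>v a \<bullet> y\<bar> \<le> 1}"
    then have "A *v y \<in> cbox (\<chi> i. - 1) (\<chi> i. 1)"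
      by (simp add: mem_box_cart comp abs_le_iff minus_le_iff)
    moreover have "y = transpose A *v (A *v y)" by (simp add: matrix_vector_mul_assoc A)
    ultimately show "y \<in> (*v) (transpose A) ` cbox (\<chi> i. - 1) (\<chi> i. 1)" by blast
  next
    fix y assume "y \<in> (*v) (transpose A) ` cbox (\<chi> i. - 1) (\<chi> i. 1)"
    then obtain z where z: "y = transpose A *v z" "z \<in> cbox (\<chi> i. - 1) (\<chi> i. 1)" by blast
    have "A *v y = z" unfolding z(1) matrix_vector_mul_assoc A by simp
    then show "y \<in> {y. \<forall>a. \<bar>v a \<bullet> y\<bar> \<le> 1}"
      using z(2) by (auto simp: mem_box_cart comp[symmetric] abs_le_iff minus_le_iff)
  qed
  ultimately show ?thesis by blast
qed

lemma closed_halfspace_unit_normal: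
  assumes "closed_halfspace H" and "cball 0 1 \<subseteq> H"
  obtains u b where "norm u = 1" "1 \<le> b" "H = {x. u \<bullet> x \<le> b}"
proof -
  obtain a c where a: "a \<noteq> 0" and H: "H = {x. a \<bullet> x \<le> c}"
    using assms(1) by (auto simp: closed_halfspace_def)
  have "a /\<^sub>R norm a \<in> H" using a assms(2) by (auto simp: subset_iff)
  then have "1 \<le> c / norm a" using a by (simp add: H divide_simps power2_norm_eq_inner[symmetric] power2_eq_square)
  moreover have "H = {x. (a /\<^sub>R norm a) \<bullet> x \<le> c / norm a}" using a by (auto simp: H field_simps)
  ultimately show ?thesis using that[of "a /\<^sub>R norm a" "c / norm a"] a by simp
qed

theorem theorem1p1:
  fixes H :: "nat \<Rightarrow> (real ^ 'n) set" and P :: "(real ^ 'n) set"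
  assumes halfspace: "\<And>i. i \<in> {1..2 * CARD('n)} \<Longrightarrow> closed_halfspace (H i)"
    and ball: "\<And>i. i \<in> {1..2 * CARD('n)} \<Longrightarrow> cball 0 1 \<subseteq> H i"
    and P: "P = (\<Inter>i\<in>{1..2 * CARD('n)}. H i)"
  shows "(\<exists>x\<in>P. norm x \<ge> sqrt (real CARD('n))) \<and>
    ((\<exists>x\<in>P. norm x = sqrt (real CARD('n)) \<and> (\<forall>y\<in>P. norm y \<le> norm x)) \<longrightarrow>
      (\<exists>U :: real ^ 'n \<Rightarrow> real ^ 'n. orthogonal_transformation U \<and>
        P = U ` cbox (\<chi> i. - 1) (\<chi> i. 1)))"
proof -
  let ?I = "{1..2 * CARD('n)}"
  have "\<forall>i\<in>?I. \<exists>u b. norm u = 1 \<and> 1 \<le> b \<and> H i = {x. u \<bullet> x \<le> b}"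
    using closed_halfspace_unit_normal[OF halfspace ball] by blast
  then obtain u b where u: "\<And>i. i \<in> ?I \<Longrightarrow> norm (u i) = 1" and b: "\<And>i. i \<in> ?I \<Longrightarrow> 1 \<le> b i"
    and H: "\<And>i. i \<in> ?I \<Longrightarrow> H i = {x. u i \<bullet> x \<le> b i}"
    by metis
  have P: "P = polyhedron_of u b ?I" using H by (auto simp: P polyhedron_of_def)
  have sub: "polyhedron_of u (\<lambda>_. 1) ?I \<subseteq> P"
    unfolding P polyhedron_of_def using b by force
  have card: "finite ?I" "card ?I = 2 * CARD('n)" by simp_all
  have "\<exists>x\<in>P. sqrt (real CARD('n)) \<le> norm x"
    using sqrt_dim_le_norm[of ?I u, OF card u] sub by blast
  moreover have "\<exists>U :: real ^ 'n \<Rightarrow> real ^ 'n. orthogonal_transformation U \<and> P = U ` cbox (\<chi> i. - 1) (\<chi> i. 1)"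
    if extremal: "\<exists>x\<in>P. norm x = sqrt (real CARD('n)) \<and> (\<forall>y\<in>P. norm y \<le> norm x)"
  proof -
    have max: "norm y \<le> sqrt (real CARD('n))" if "y \<in> P" for y
      using extremal that by auto
    then have max1: "norm y \<le> sqrt (real CARD('n))" if "y \<in> polyhedron_of u (\<lambda>_. 1) ?I" for y
      using that sub by blast
    obtain e where e: "range e \<subseteq> ?I" "det (row_matrix u e) \<noteq> 0"
      "(norm (vertex u (\<lambda>_. 1) e))\<^sup>2 = CARD('n)"
      "\<And>i. i \<in> ?I \<Longrightarrow> u i \<bullet> vertex u (\<lambda>_. 1) e = (if i \<in> range e then 1 else - 1)"
      using sign_vertex_if_extremal[of ?I u, OF card u max1] by blast
    have facets: "dual_vector u e a = u (e a)" "\<exists>j\<in>?I. u j = - u (e a)" for a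
      by (rule facets_if_extremal[OF card(1) _ _ e(1-3)], erule u, erule max1, erule e(4))+
    have on: "u (e a) \<bullet> u (e c) = (if a = c then 1 else 0)" for a c
      using inner_dual_vector[OF e(2), of a c] by (simp add: facets(1))
    have "\<forall>a. \<exists>j. j \<in> ?I \<and> u j = - u (e a)" using facets(2) by blast
    then obtain g where g: "\<And>a. g a \<in> ?I" "\<And>a. u (g a) = - u (e a)" by metis
    have "inj g"
    proof (rule injI)
      fix a c assume "g a = g c"
      then have "u (e a) = u (e c)" using g(2) by (metis neg_equal_iff_equal)
      then show "a = c" using on[of a a] on[of a c] by (metis zero_neq_one)
    qed
    moreover have "range e \<inter> range g = {}"
    proof -
      have "e a \<noteq> g c" for a c
      proof
        assume "e a = g c"
        then have "u (e a) = - u (e c)" using g(2) by metis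
        then have "u (e a) \<bullet> u (e a) = - (u (e a) \<bullet> u (e c))" by (metis inner_minus_right)
        then show False using on[of a a] on[of a c] by (simp split: if_splits)
      qed
      then show ?thesis by auto
    qed
    ultimately have I: "?I = range e \<union> range g"
      using e(1) g(1) inj_if_det_row_matrix_nonzero[OF e(2)] by (intro index_set_covered[OF card]) auto
    have "\<exists>a. u i = u (e a) \<or> u i = - u (e a)" if "i \<in> ?I" for i
      using that g(2) unfolding I by blast
    then have "P = {y. \<forall>a. \<bar>u (e a) \<bullet> y\<bar> \<le> 1}"
      unfolding P using b max[unfolded P] by (intro polyhedron_eq_cube on) auto
    then show ?thesis using cube_eq_orthogonal_image[of "\<lambda>a. u (e a)", OF on] by simp
  qed
  ultimately show ?thesis by blast
qed

end
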